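(* Let $z\in\mathfrak F_\infty$ and $m\ge 2$. Then the set $\mathrm{RF}^m_{\mathsf{FPF}}(z)$, equipped with the weight map $\mathrm{wt}(w^1\cdots w^m)=\sum_{i=1}^m |w^i|\epsilon_i$, the even Kashiwara operators $\tilde e_i^F,\tilde f_i^F$ ($i=1,\dots,m-1$) of Morse–Schilling, and the odd Kashiwara operators $\tilde e_{\bar 1}^F,\tilde f_{\bar 1}^F$ described below, is a $\mathfrak q(m)$-crystal.
   Context: Let $s_i$ be the simple transposition $(i\ i{+}1)$ of the positive integers, $\mathfrak S_\infty$ the group of finitely supported permutations of $\{1,2,\dots\}$, $\Theta=(1\,2)(3\,4)(5\,6)\cdots$, and $\mathfrak F_\infty=\{\pi^{-1}\Theta\pi:\pi\in\mathfrak S_\infty\}$. For $z\in\mathfrak F_\infty$, an FPF-involution word for $z$ is a word (finite sequence of positive integers) $i_1\cdots i_l$ with $z=s_{i_l}\cdots s_{i_1}\Theta s_{i_1}\cdots s_{i_l}$ and $l$ minimal among such words; $\hat{\mathcal R}_{\mathsf{FPF}}(z)$ denotes their set. An increasing factorization with $m$ blocks of a word $w$ is a sequence $w^1w^2\cdots w^m$ of strictly increasing (possibly empty) words whose concatenation is $w$; $\mathrm{RF}^m_{\mathsf{FPF}}(z)$ is the set of increasing factorizations with $m$ blocks of all $w\in\hat{\mathcal R}_{\mathsf{FPF}}(z)$. $|w^i|$ is the length and $\mathrm{cont}(w^i)$ the set of letters of $w^i$; a strictly increasing word is determined by its content. Even operators (Morse–Schilling): $\tilde e_i^F,\tilde f_i^F$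 act only on blocks $w^iw^{i+1}$. Pair letters as follows: take the largest $b\in\mathrm{cont}(w^{i+1})$ and pair it with the smallest $a>b$ in $\mathrm{cont}(w^i)$ (if none, $b$ is unpaired); proceed in decreasing order through the letters of $w^{i+1}$, ignoring already paired letters of $w^i$. Let $R_i$ (resp. $L_i$) be the set of unpaired letters of $w^{i+1}$ (resp. $w^i$). If $L_i=\emptyset$, $\tilde f_i^F=\mathbf 0$; otherwise with $c=\max L_i$ and $s=\min\{j\ge0: c+j+1\notin\mathrm{cont}(w^i)\}$, $\tilde f_i^F$ replaces $w^i,w^{i+1}$ by the increasing words with contents $\mathrm{cont}(w^i)\setminus\{c\}$ and $\mathrm{cont}(w^{i+1})\cup\{c+s\}$. If $R_i=\emptyset$, $\tilde e_i^F=\mathbf 0$; otherwise with $c=\min R_i$ and $t=\min\{j\ge0:c-j-1\notin\mathrm{cont}(w^{i+1})\}$, $\tilde e_i^F$ replaces them by the increasing words with contents $\mathrm{cont}(w^i)\cup\{c-t\}$ and $\mathrm{cont}(w^{i+1})\setminus\{c\}$. Odd operators (they change only the first two blocks; write $w^1=u_1u_2\cdots$, $w^2=v_1\cdots$). $\tilde f_{\bar1}^F$: if $|w^1|=0$ it is $\mathbf 0$; if $|w^1|=1$ and $u_1<\min\mathrm{cont}(w^2)$, the new blocks are $()$ and the word with content $\mathrm{cont}(w^2)\cup\{u_1\}$; if $|w^1|\ge2$, $u_2>u_1+1$ and $u_1<\min\mathrm{cont}(w^2)$, the new blocks have contents $\mathrm{cont}(w^1)\setminus\{u_1\}$ and $\mathrm{cont}(w^2)\cup\{u_1\}$;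 if $|w^1|\ge2$, $u_2=u_1+1$ and $u_1<\min\mathrm{cont}(w^2)$, the new blocks have contents $\mathrm{cont}(w^1)\setminus\{u_1+1\}$ and $\mathrm{cont}(w^2)\cup\{u_1-1\}$; otherwise $\mathbf 0$; when $|w^2|=0$ the condition $u_1<\min\mathrm{cont}(w^2)$ is dropped. $\tilde e_{\bar1}^F$: if $|w^2|=0$ it is $\mathbf 0$; if $|w^1|=0\ne|w^2|$, the new blocks are $v_1$ and the word with content $\mathrm{cont}(w^2)\setminus\{v_1\}$; if both are nonempty and $u_1>v_1+1$, the new contents are $\mathrm{cont}(w^1)\cup\{v_1\}$ and $\mathrm{cont}(w^2)\setminus\{v_1\}$; if $u_1=v_1+1$, the new contents are $\mathrm{cont}(w^1)\cup\{u_1+1\}$ and $\mathrm{cont}(w^2)\setminus\{u_1-1\}$; otherwise $\mathbf 0$. Crystals: $P=\bigoplus_{i=1}^m\mathbb Z\epsilon_i$, $\langle\epsilon_i,k_j\rangle=\delta_{ij}$, $\alpha_i=\epsilon_i-\epsilon_{i+1}$, $h_i=k_i-k_{i+1}$. A $\mathfrak{gl}(m)$-crystal is a set $B$ with $\mathrm{wt}:B\to P$ and $\tilde e_i,\tilde f_i:B\to B\sqcup\{\mathbf 0\}$ ($1\le i\le m-1$) such that, with $\varepsilon_i(b)=\max\{k:\tilde e_i^kb\in B\}$ and $\varphi_i(b)=\max\{k:\tilde f_i^kb\in B\}$: these are finite and $\varphi_i(b)=\varepsilon_i(b)+\langle\mathrm{wt}(b),h_i\rangle$; if $\tilde e_ib\ne\mathbf0$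 then $\mathrm{wt}(\tilde e_ib)=\mathrm{wt}(b)+\alpha_i$, $\varepsilon_i(\tilde e_ib)=\varepsilon_i(b)-1$, $\varphi_i(\tilde e_ib)=\varphi_i(b)+1$; if $\tilde f_ib\ne\mathbf0$ then $\mathrm{wt}(\tilde f_ib)=\mathrm{wt}(b)-\alpha_i$, $\varepsilon_i(\tilde f_ib)=\varepsilon_i(b)+1$, $\varphi_i(\tilde f_ib)=\varphi_i(b)-1$; and $\tilde f_ib=b'\iff\tilde e_ib'=b$. A $\mathfrak q(m)$-crystal is such a $B$ together with $\tilde e_{\bar1},\tilde f_{\bar1}:B\to B\sqcup\{\mathbf0\}$ such that $\mathrm{wt}(b)\in\bigoplus\mathbb Z_{\ge0}\epsilon_i$; $\mathrm{wt}(\tilde e_{\bar1}b)=\mathrm{wt}(b)+\alpha_1$ and $\mathrm{wt}(\tilde f_{\bar1}b)=\mathrm{wt}(b)-\alpha_1$ (when nonzero); $\tilde f_{\bar1}b=b'\iff\tilde e_{\bar1}b'=b$; and for $3\le i\le m-1$, $\tilde e_{\bar1},\tilde f_{\bar1}$ commute with $\tilde e_i,\tilde f_i$, and if $\tilde e_{\bar1}b\in B$ then $\varepsilon_i(\tilde e_{\bar1}b)=\varepsilon_i(b)$, $\varphi_i(\tilde e_{\bar1}b)=\varphi_i(b)$. *)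

theory Defs
  imports
    "HOL-Combinatorics.Permutations"
    "HOL-Library.Poly_Mapping"
begin

text \<open>Permutations of the positive integers are maps on \<^typ>\<open>nat\<close> that fix \<open>0\<close>.\<close>

definition simple_transp :: "nat \<Rightarrow> nat \<Rightarrow> nat" where
  "simple_transp i = transpose i (i + 1)"

definition S_inf :: "(nat \<Rightarrow> nat) set" where
  "S_inf = {\<pi>. \<pi> permutes {1..} \<and> finite {x. \<pi> x \<noteq> x}}"

definition Theta :: "nat \<Rightarrow> nat" where
  "Theta n = (if n = 0 then 0 else if odd n then n + 1 else n - 1)"

definition F_inf :: "(nat \<Rightarrow> nat) set" where
  "F_inf = {inv \<pi> \<circ> Theta \<circ> \<pi> | \<pi>. \<pi> \<in> S_inf}"

definition word_perm :: "nat list \<Rightarrow> nat \<Rightarrow> nat" where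
  "word_perm w = foldr (\<lambda>i p. simple_transp i \<circ> p) w id"

definition fpf_expression :: "(nat \<Rightarrow> nat) \<Rightarrow> nat list \<Rightarrow> bool" where
  "fpf_expression z w \<longleftrightarrow>
     set w \<subseteq> {1..} \<and> z = word_perm (rev w) \<circ> Theta \<circ> word_perm w"

definition fpf_involution_words :: "(nat \<Rightarrow> nat) \<Rightarrow> nat list set" where
  "fpf_involution_words z =
     {w. fpf_expression z w \<and> (\<forall>w'. fpf_expression z w' \<longrightarrow> length w \<le> length w')}"

text \<open>A factorization is the list of its blocks, so block \<open>w\<^sup>i\<close> of \<open>ws\<close> is \<open>ws ! (i - 1)\<close>.\<close>

definition RF_fpf :: "nat \<Rightarrow> (nat \<Rightarrow> nat) \<Rightarrow> nat list list set" where
  "RF_fpf m z =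
     {ws. length ws = m \<and> (\<forall>u\<in>set ws. sorted_wrt (<) u) \<and> concat ws \<in> fpf_involution_words z}"

text \<open>
  The weight lattice is the set of all \<open>p :: nat \<Rightarrow>\<^sub>0 int\<close> with \<open>keys p \<subseteq> {1..m}\<close>; thus
  \<open>\<epsilon>\<^sub>i\<close> is \<open>single i 1\<close> and \<open>\<langle>p, k\<^sub>j\<rangle>\<close> is \<open>lookup p j\<close>.
  The element \<open>\<zero>\<close> adjoined to a crystal is \<^const>\<open>None\<close>.
\<close>

definition simple_root :: "nat \<Rightarrow> (nat \<Rightarrow>\<^sub>0 int)" where
  "simple_root i = Poly_Mapping.single i 1 - Poly_Mapping.single (i + 1) 1"

definition coroot_pairing :: "(nat \<Rightarrow>\<^sub>0 int) \<Rightarrow> nat \<Rightarrow> int" where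
  "coroot_pairing p i = Poly_Mapping.lookup p i - Poly_Mapping.lookup p (i + 1)"

definition op_power :: "('b \<Rightarrow> 'b option) \<Rightarrow> nat \<Rightarrow> 'b \<Rightarrow> 'b option" where
  "op_power g k b = ((\<lambda>x. Option.bind x g) ^^ k) (Some b)"

definition string_set :: "'b set \<Rightarrow> ('b \<Rightarrow> 'b option) \<Rightarrow> 'b \<Rightarrow> nat set" where
  "string_set B g b = {k. op_power g k b \<in> Some ` B}"

definition string_length :: "'b set \<Rightarrow> ('b \<Rightarrow> 'b option) \<Rightarrow> 'b \<Rightarrow> int" where
  "string_length B g b = int (Max (string_set B g b))"

text \<open>\<open>string_length B (e i)\<close> is \<open>\<epsilon>\<^sub>i\<close> and \<open>string_length B (f i)\<close> is \<open>\<phi>\<^sub>i\<close>.\<close>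

locale gl_crystal =
  fixes m :: nat
    and B :: "'b set"
    and wt :: "'b \<Rightarrow> (nat \<Rightarrow>\<^sub>0 int)"
    and e f :: "nat \<Rightarrow> 'b \<Rightarrow> 'b option"
  assumes wt_lattice: "b \<in> B \<Longrightarrow> Poly_Mapping.keys (wt b) \<subseteq> {1..m}"
    and e_closed: "\<lbrakk>1 \<le> i; i < m; b \<in> B; e i b = Some b'\<rbrakk> \<Longrightarrow> b' \<in> B"
    and f_closed: "\<lbrakk>1 \<le> i; i < m; b \<in> B; f i b = Some b'\<rbrakk> \<Longrightarrow> b' \<in> B"
    and e_finite: "\<lbrakk>1 \<le> i; i < m; b \<in> B\<rbrakk> \<Longrightarrow> finite (string_set B (e i) b)"
    and f_finite: "\<lbrakk>1 \<le> i; i < m; b \<in> B\<rbrakk> \<Longrightarrow> finite (string_set B (f i) b)"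
    and phi_eps: "\<lbrakk>1 \<le> i; i < m; b \<in> B\<rbrakk> \<Longrightarrow>
      string_length B (f i) b = string_length B (e i) b + coroot_pairing (wt b) i"
    and e_wt: "\<lbrakk>1 \<le> i; i < m; b \<in> B; e i b = Some b'\<rbrakk> \<Longrightarrow> wt b' = wt b + simple_root i"
    and e_eps: "\<lbrakk>1 \<le> i; i < m; b \<in> B; e i b = Some b'\<rbrakk> \<Longrightarrow>
      string_length B (e i) b' = string_length B (e i) b - 1"
    and e_phi: "\<lbrakk>1 \<le> i; i < m; b \<in> B; e i b = Some b'\<rbrakk> \<Longrightarrow>
      string_length B (f i) b' = string_length B (f i) b + 1"
    and f_wt: "\<lbrakk>1 \<le> i; i < m; b \<in> B; f i b = Some b'\<rbrakk> \<Longrightarrow> wt b' = wt b - simple_root i"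
    and f_eps: "\<lbrakk>1 \<le> i; i < m; b \<in> B; f i b = Some b'\<rbrakk> \<Longrightarrow>
      string_length B (e i) b' = string_length B (e i) b + 1"
    and f_phi: "\<lbrakk>1 \<le> i; i < m; b \<in> B; f i b = Some b'\<rbrakk> \<Longrightarrow>
      string_length B (f i) b' = string_length B (f i) b - 1"
    and f_iff_e: "\<lbrakk>1 \<le> i; i < m; b \<in> B; b' \<in> B\<rbrakk> \<Longrightarrow> f i b = Some b' \<longleftrightarrow> e i b' = Some b"

locale q_crystal = gl_crystal m B wt e f
  for m :: nat
    and B :: "'b set"
    and wt :: "'b \<Rightarrow> (nat \<Rightarrow>\<^sub>0 int)"
    and e f :: "nat \<Rightarrow> 'b \<Rightarrow> 'b option" +
  fixes e_odd f_odd :: "'b \<Rightarrow> 'b option"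
  assumes wt_nonneg: "\<lbrakk>b \<in> B; 1 \<le> i; i \<le> m\<rbrakk> \<Longrightarrow> 0 \<le> Poly_Mapping.lookup (wt b) i"
    and e_odd_closed: "\<lbrakk>b \<in> B; e_odd b = Some b'\<rbrakk> \<Longrightarrow> b' \<in> B"
    and f_odd_closed: "\<lbrakk>b \<in> B; f_odd b = Some b'\<rbrakk> \<Longrightarrow> b' \<in> B"
    and e_odd_wt: "\<lbrakk>b \<in> B; e_odd b = Some b'\<rbrakk> \<Longrightarrow> wt b' = wt b + simple_root 1"
    and f_odd_wt: "\<lbrakk>b \<in> B; f_odd b = Some b'\<rbrakk> \<Longrightarrow> wt b' = wt b - simple_root 1"
    and f_odd_iff_e_odd: "\<lbrakk>b \<in> B; b' \<in> B\<rbrakk> \<Longrightarrow> f_odd b = Some b' \<longleftrightarrow> e_odd b' = Some b"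
    and e_odd_e: "\<lbrakk>3 \<le> i; i < m; b \<in> B\<rbrakk> \<Longrightarrow>
      Option.bind (e i b) e_odd = Option.bind (e_odd b) (e i)"
    and e_odd_f: "\<lbrakk>3 \<le> i; i < m; b \<in> B\<rbrakk> \<Longrightarrow>
      Option.bind (f i b) e_odd = Option.bind (e_odd b) (f i)"
    and f_odd_e: "\<lbrakk>3 \<le> i; i < m; b \<in> B\<rbrakk> \<Longrightarrow>
      Option.bind (e i b) f_odd = Option.bind (f_odd b) (e i)"
    and f_odd_f: "\<lbrakk>3 \<le> i; i < m; b \<in> B\<rbrakk> \<Longrightarrow>
      Option.bind (f i b) f_odd = Option.bind (f_odd b) (f i)"
    and e_odd_eps: "\<lbrakk>3 \<le> i; i < m; b \<in> B; e_odd b = Some b'\<rbrakk> \<Longrightarrow>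
      string_length B (e i) b' = string_length B (e i) b"
    and e_odd_phi: "\<lbrakk>3 \<le> i; i < m; b \<in> B; e_odd b = Some b'\<rbrakk> \<Longrightarrow>
      string_length B (f i) b' = string_length B (f i) b"

definition rf_wt :: "nat list list \<Rightarrow> (nat \<Rightarrow>\<^sub>0 int)" where
  "rf_wt ws = (\<Sum>i=1..length ws. Poly_Mapping.single i (int (length (ws ! (i - 1)))))"

abbreviation incr_word :: "nat set \<Rightarrow> nat list" where
  "incr_word \<equiv> sorted_list_of_set"

text \<open>
  The first argument lists the letters of \<open>w\<^sup>i\<^sup>+\<^sup>1\<close> still to be treated, in decreasing order; the
  second is the set of letters of \<open>w\<^sup>i\<close> that are not yet paired. The result is \<open>(R\<^sub>i, L\<^sub>i)\<close>.
\<close>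

fun pairing :: "nat list \<Rightarrow> nat set \<Rightarrow> nat set \<times> nat set" where
  "pairing [] A = ({}, A)"
| "pairing (b # bs) A =
    (if \<exists>a\<in>A. b < a then pairing bs (A - {LEAST a. a \<in> A \<and> b < a})
     else (let (R, L) = pairing bs A in (insert b R, L)))"

definition unpaired_R :: "nat list \<Rightarrow> nat list \<Rightarrow> nat set" where
  "unpaired_R u v = fst (pairing (rev v) (set u))"

definition unpaired_L :: "nat list \<Rightarrow> nat list \<Rightarrow> nat set" where
  "unpaired_L u v = snd (pairing (rev v) (set u))"

definition f_even :: "nat \<Rightarrow> nat list list \<Rightarrow> nat list list option" where
  "f_even i ws =
    (let u = ws ! (i - 1); v = ws ! i; L = unpaired_L u v in
     if L = {} then None
     else
       let c = Max L; s = (LEAST j. c + j + 1 \<notin> set u) in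
       Some (ws[i - 1 := incr_word (set u - {c}), i := incr_word (set v \<union> {c + s})]))"

text \<open>
  Since \<open>0\<close> is never a letter, the minimum defining \<open>t\<close> is attained with \<open>c - t \<ge> 1\<close>, and the
  truncated subtraction on \<^typ>\<open>nat\<close> is harmless.
\<close>

definition e_even :: "nat \<Rightarrow> nat list list \<Rightarrow> nat list list option" where
  "e_even i ws =
    (let u = ws ! (i - 1); v = ws ! i; R = unpaired_R u v in
     if R = {} then None
     else
       let c = Min R; t = (LEAST j. c - j - 1 \<notin> set v) in
       Some (ws[i - 1 := incr_word (set u \<union> {c - t}), i := incr_word (set v - {c})]))"

definition f_odd_op :: "nat list list \<Rightarrow> nat list list option" where
  "f_odd_op ws =
    (let u = ws ! 0; v = ws ! 1; small = (v = [] \<or> u ! 0 < Min (set v)) in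
     if length u = 0 then None
     else if length u = 1 \<and> small then
       Some (ws[0 := [], 1 := incr_word (set v \<union> {u ! 0})])
     else if 2 \<le> length u \<and> u ! 1 > u ! 0 + 1 \<and> small then
       Some (ws[0 := incr_word (set u - {u ! 0}), 1 := incr_word (set v \<union> {u ! 0})])
     else if 2 \<le> length u \<and> u ! 1 = u ! 0 + 1 \<and> small then
       Some (ws[0 := incr_word (set u - {u ! 0 + 1}), 1 := incr_word (set v \<union> {u ! 0 - 1})])
     else None)"

definition e_odd_op :: "nat list list \<Rightarrow> nat list list option" where
  "e_odd_op ws =
    (let u = ws ! 0; v = ws ! 1 in
     if length v = 0 then None
     else if length u = 0 then
       Some (ws[0 := [v ! 0], 1 := incr_word (set v - {v ! 0})])
     else if u ! 0 > v ! 0 + 1 then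
       Some (ws[0 := incr_word (set u \<union> {v ! 0}), 1 := incr_word (set v - {v ! 0})])
     else if u ! 0 = v ! 0 + 1 then
       Some (ws[0 := incr_word (set u \<union> {u ! 0 + 1}), 1 := incr_word (set v - {u ! 0 - 1})])
     else None)"

end

theory Submission
  imports Defs
begin

text \<open>
  All operators preserve the length of the concatenated word and the conjugate of \<open>\<Theta>\<close> that it
  represents, hence also minimality.

  Encode a pair of adjacent blocks as a lattice path. The unpaired letters of the left block are
  the strict running minima of the path, those of the right block the points after which the path
  stays strictly higher. So \<open>f\<close> acts at the first and \<open>e\<close> at the last point where the minimum is
  attained. The word relation behind both is
  \<open>(c \<dots> c+s)(c \<dots> c+s-1) = (c+1 \<dots> c+s)(c \<dots> c+s)\<close>, and minimality forbids \<open>(c \<dots> c+s)(c \<dots> c+s)\<close>.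

  The odd operators move a letter by commutations, except when the first block starts with
  \<open>a, a+1\<close>. A minimal word starts with an even letter, because \<open>s\<^sub>a\<close> fixes \<open>\<Theta>\<close> under conjugation for
  odd \<open>a\<close>; and for even \<open>a\<close> the beginnings \<open>a, a+1\<close> and \<open>a, a-1\<close> represent the same conjugate.
\<close>

section \<open>Words and conjugates of Theta\<close>

lemma simple_transp_involutory [simp]: "simple_transp i \<circ> simple_transp i = id"
  by (simp add: simple_transp_def)

lemma simple_transp_commute:
  "i + 1 < j \<or> j + 1 < i \<Longrightarrow> simple_transp i \<circ> simple_transp j = simple_transp j \<circ> simple_transp i"
  by (auto simp: fun_eq_iff simple_transp_def transpose_def)

lemma simple_transp_braid:
  "simple_transp i \<circ> (simple_transp (Suc i) \<circ> simple_transp i) =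
   simple_transp (Suc i) \<circ> (simple_transp i \<circ> simple_transp (Suc i))"
  by (auto simp: fun_eq_iff simple_transp_def transpose_def)

lemma word_perm_Nil [simp]: "word_perm [] = id"
  by (simp add: word_perm_def)

lemma word_perm_Cons: "word_perm (i # w) = simple_transp i \<circ> word_perm w"
  by (simp add: word_perm_def)

lemma word_perm_append: "word_perm (u @ v) = word_perm u \<circ> word_perm v"
  by (induction u) (simp_all add: word_perm_Cons comp_assoc)

lemma word_perm_append_cong:
  "word_perm u = word_perm u' \<Longrightarrow> word_perm v = word_perm v' \<Longrightarrow> word_perm (u @ v) = word_perm (u' @ v')"
  by (simp add: word_perm_append)

lemma word_perm_rev_comp: "word_perm (rev w) \<circ> word_perm w = id"
proof (induction w)
  case (Cons i w)
  have "word_perm (rev (i # w)) \<circ> word_perm (i # w) =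
        word_perm (rev w) \<circ> (simple_transp i \<circ> simple_transp i) \<circ> word_perm w"
    by (simp only: rev.simps word_perm_append word_perm_Cons word_perm_Nil comp_assoc id_comp comp_id)
  then show ?case using Cons by simp
qed simp

lemma word_perm_rev: "word_perm (rev w) = inv (word_perm w)"
  using word_perm_rev_comp[of w] word_perm_rev_comp[of "rev w"]
  by (metis inv_unique_comp rev_rev_ident)

lemma word_perm_commute_letter:
  assumes "\<And>y. y \<in> set w \<Longrightarrow> i + 1 < y \<or> y + 1 < i"
  shows "word_perm (w @ [i]) = word_perm (i # w)"
  using assms
proof (induction w)
  case (Cons y w)
  have "word_perm (w @ [i]) = word_perm (i # w)"
    using Cons by auto
  then have "word_perm ((y # w) @ [i]) = (simple_transp y \<circ> simple_transp i) \<circ> word_perm w"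
    by (simp only: append_Cons word_perm_Cons comp_assoc)
  also have "simple_transp y \<circ> simple_transp i = simple_transp i \<circ> simple_transp y"
    using Cons.prems[of y] by (intro simple_transp_commute) auto
  finally show ?case by (simp only: word_perm_Cons comp_assoc)
qed simp

lemma word_perm_commute:
  assumes "\<And>x y. x \<in> set u \<Longrightarrow> y \<in> set v \<Longrightarrow> x + 1 < y \<or> y + 1 < x"
  shows "word_perm (u @ v) = word_perm (v @ u)"
  using assms
proof (induction v)
  case (Cons i v)
  have "word_perm (u @ i # v) = word_perm (u @ [i]) \<circ> word_perm v"
    by (simp add: word_perm_append word_perm_Cons comp_assoc)
  also have "word_perm (u @ [i]) = word_perm (i # u)"
    using Cons.prems by (intro word_perm_commute_letter) fastforce
  also have "word_perm (i # u) \<circ> word_perm v = simple_transp i \<circ> word_perm (u @ v)"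
    by (simp only: word_perm_Cons word_perm_append comp_assoc)
  also have "word_perm (u @ v) = word_perm (v @ u)"
    using Cons by auto
  finally show ?case
    by (simp only: word_perm_Cons append_Cons)
qed simp

text \<open>Induction on \<open>s\<close>: the new top letter moves right past letters at least two
  below it, the induction hypothesis rearranges the two shorter runs, a braid move is made at the
  top, and the left copy of the top letter that it creates moves back.\<close>

lemma word_perm_staircase:
  "word_perm ([c..<c + s + 1] @ [c..<c + s]) = word_perm ([c + 1..<c + s + 1] @ [c..<c + s + 1])"
proof (induction s)
  case (Suc s)
  let ?d = "c + s"
  have "word_perm ([c..<c + Suc s + 1] @ [c..<c + Suc s]) =
      word_perm [c..<?d + 1] \<circ> word_perm ([Suc ?d] @ [c..<?d]) \<circ> simple_transp ?d"
    by (simp add: word_perm_append word_perm_Cons comp_assoc)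
  also have "word_perm ([Suc ?d] @ [c..<?d]) = word_perm ([c..<?d] @ [Suc ?d])"
    by (rule word_perm_commute) auto
  also have "word_perm [c..<?d + 1] \<circ> word_perm ([c..<?d] @ [Suc ?d]) \<circ> simple_transp ?d =
      word_perm ([c..<?d + 1] @ [c..<?d]) \<circ> simple_transp (Suc ?d) \<circ> simple_transp ?d"
    by (simp add: word_perm_append word_perm_Cons comp_assoc)
  also have "word_perm ([c..<?d + 1] @ [c..<?d]) = word_perm ([c + 1..<?d + 1] @ [c..<?d + 1])"
    by (rule Suc)
  also have "\<dots> \<circ> simple_transp (Suc ?d) \<circ> simple_transp ?d =
      word_perm [c + 1..<?d + 1] \<circ> word_perm [c..<?d] \<circ>
        (simple_transp ?d \<circ> (simple_transp (Suc ?d) \<circ> simple_transp ?d))"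
    by (simp add: word_perm_append word_perm_Cons comp_assoc)
  also have "\<dots> = word_perm [c + 1..<?d + 1] \<circ> word_perm ([c..<?d] @ [Suc ?d]) \<circ>
        simple_transp ?d \<circ> simple_transp (Suc ?d)"
    unfolding simple_transp_braid by (simp add: word_perm_append word_perm_Cons comp_assoc)
  also have "word_perm ([c..<?d] @ [Suc ?d]) = word_perm ([Suc ?d] @ [c..<?d])"
    by (rule word_perm_commute) auto
  finally show ?case
    by (simp add: word_perm_append word_perm_Cons comp_assoc)
qed simp

section \<open>Conjugates of \<open>Theta\<close> and minimal words\<close>

definition twist :: "nat list \<Rightarrow> nat \<Rightarrow> nat" where
  "twist w = word_perm (rev w) \<circ> Theta \<circ> word_perm w"

lemma twist_append: "twist (u @ v) = word_perm (rev v) \<circ> twist u \<circ> word_perm v"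
  by (simp add: twist_def word_perm_append comp_assoc)

lemma twist_append_cong: "twist u = twist u' \<Longrightarrow> twist (u @ v) = twist (u' @ v)"
  by (simp add: twist_append)

lemma twist_cong: "word_perm w = word_perm w' \<Longrightarrow> twist w = twist w'"
  by (simp add: twist_def word_perm_rev)

text \<open>For odd \<open>a\<close> the transposition of \<open>a\<close> and \<open>a + 1\<close>
  is one of the cycles of \<open>Theta\<close>, so it commutes with \<open>Theta\<close>.\<close>

lemma twist_odd_letter:
  assumes "odd a"
  shows "twist [a] = twist []"
proof
  fix x
  have a: "Theta a = Suc a" "Theta (Suc a) = a"
    using assms by (auto simp: Theta_def elim: oddE)
  show "twist [a] x = twist [] x"
  proof (cases "x = a \<or> x = Suc a")
    case True
    with a show ?thesis
      by (auto simp: twist_def word_perm_Cons simple_transp_def)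
  next
    case False
    then have "Theta x \<noteq> a" "Theta x \<noteq> Suc a"
      using assms unfolding Theta_def by presburger+
    with False show ?thesis
      by (simp add: twist_def word_perm_Cons simple_transp_def transpose_def)
  qed
qed

text \<open>\<open>Theta\<close> pairs \<open>a - 1\<close> with \<open>a\<close> and
  \<open>a + 1\<close> with \<open>a + 2\<close>. Either word turns this into the nested pairs
  \<open>a\<close>, \<open>a + 1\<close> and \<open>a - 1\<close>, \<open>a + 2\<close>, and nothing
  else changes.\<close>

lemma twist_even_letter:
  assumes "even a" "0 < a"
  shows "twist [a, a + 1] = twist [a, a - 1]"
proof
  fix x
  obtain d where d: "a = Suc d" "odd d"
    using assms by (cases a) auto
  have val: "Theta d = Suc d" "Theta (Suc d) = d"
      "Theta (Suc (Suc d)) = Suc (Suc (Suc d))" "Theta (Suc (Suc (Suc d))) = Suc (Suc d)"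
    using d by (auto simp: Theta_def elim: oddE)
  show "twist [a, a + 1] x = twist [a, a - 1] x"
  proof (cases "x = d \<or> x = Suc d \<or> x = Suc (Suc d) \<or> x = Suc (Suc (Suc d))")
    case True
    with val show ?thesis
      by (elim disjE) (simp_all add: d(1) twist_def word_perm_Cons simple_transp_def transpose_def)
  next
    case False
    then have "Theta x \<noteq> d" "Theta x \<noteq> Suc d" "Theta x \<noteq> Suc (Suc d)" "Theta x \<noteq> Suc (Suc (Suc d))"
      using d(2) unfolding Theta_def by presburger+
    with False show ?thesis
      by (simp add: d(1) twist_def word_perm_Cons simple_transp_def transpose_def)
  qed
qed

lemma fpf_expression_iff: "fpf_expression z w \<longleftrightarrow> 0 \<notin> set w \<and> z = twist w"
  by (auto simp: fpf_expression_def twist_def Suc_le_eq intro: gr0I)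

lemma fpf_words_minimal:
  assumes "w \<in> fpf_involution_words z" "twist w' = twist w" "0 \<notin> set w'"
  shows "length w \<le> length w'"
  using assms by (auto simp: fpf_involution_words_def fpf_expression_iff)

lemma fpf_words_cong:
  assumes "w \<in> fpf_involution_words z" "twist w' = twist w" "0 \<notin> set w'" "length w' = length w"
  shows "w' \<in> fpf_involution_words z"
  using assms by (auto simp: fpf_involution_words_def fpf_expression_iff)

lemma fpf_words_pos: "w \<in> fpf_involution_words z \<Longrightarrow> 0 \<notin> set w"
  by (auto simp: fpf_involution_words_def fpf_expression_iff)

lemma fpf_words_head_even:
  assumes "a # w \<in> fpf_involution_words z"
  shows "even a"
proof (rule ccontr)
  assume "odd a"
  then have "twist w = twist (a # w)"
    using twist_append_cong[OF twist_odd_letter, of a w] by simp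
  then have "length (a # w) \<le> length w"
    using assms fpf_words_pos[OF assms] by (intro fpf_words_minimal) auto
  then show False by simp
qed

section \<open>The pairing as a lattice path\<close>

text \<open>
  Read the letters of \<open>v\<close> as opening and those of \<open>u\<close> as closing brackets, the closing bracket
  at a position standing before the opening one there. Then \<open>height (set u) (set v) y\<close> is the height of
  the bracket path between the two brackets at \<open>y\<close>.
\<close>

definition height :: "nat set \<Rightarrow> nat set \<Rightarrow> nat \<Rightarrow> int" where
  "height U V y = int (card (V \<inter> {..<y})) - int (card (U \<inter> {..y}))"

text \<open>The point 0 satisfies the condition on smaller points vacuously but is never a letter;
  hence \<open>0 < a\<close>.\<close>

definition records :: "(nat \<Rightarrow> int) \<Rightarrow> nat set" where
  "records h = {a. 0 < a \<and> (\<forall>x<a. h a < h x)}"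

definition exits :: "(nat \<Rightarrow> int) \<Rightarrow> nat set" where
  "exits h = {b. \<forall>y>b. h b < h y}"

text \<open>The step from \<open>y\<close> to \<open>Suc y\<close> crosses the opening bracket at
  \<open>y\<close> and then the closing one at \<open>Suc y\<close>, so a letter \<open>y\<close> of
  \<open>V\<close> and a letter \<open>Suc y\<close> of \<open>U\<close> cancel in one step, just as
  the pairing matches them.\<close>

lemma height_Suc: "height U V (Suc y) = height U V y + of_bool (y \<in> V) - of_bool (Suc y \<in> U)"
  by (simp add: height_def lessThan_Suc atMost_Suc Int_insert_right)

lemma height_insert_left: "c \<notin> U \<Longrightarrow> height (insert c U) V y = height U V y - of_bool (c \<le> y)"
  by (simp add: height_def Int_insert_left)

lemma height_insert_right: "d \<notin> V \<Longrightarrow> height U (insert d V) y = height U V y + of_bool (d < y)"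
  by (simp add: height_def Int_insert_left)

lemma height_lower_bound: "finite U \<Longrightarrow> - int (card U) \<le> height U V y"
  unfolding height_def using card_mono[of U "U \<inter> {..y}"] by simp

lemma height_const:
  assumes "\<And>z. x \<le> z \<Longrightarrow> z < y \<Longrightarrow> (z \<in> V \<longleftrightarrow> Suc z \<in> U)" and "x \<le> y"
  shows "height U V y = height U V x"
  using assms(2,1) by (induction y rule: dec_induct) (auto simp: height_Suc)

lemma records_subset: "records (height U V) \<subseteq> U"
proof
  fix a assume a: "a \<in> records (height U V)"
  then obtain b where b: "a = Suc b" by (cases a) (auto simp: records_def)
  with a have "height U V (Suc b) < height U V b" by (simp add: records_def)
  then show "a \<in> U" by (cases "Suc b \<in> U"; cases "b \<in> V") (auto simp: b height_Suc)
qed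

lemma exits_subset: "exits (height U V) \<subseteq> V"
proof
  fix b assume "b \<in> exits (height U V)"
  then have "height U V b < height U V (Suc b)" by (simp add: exits_def)
  then show "b \<in> V" by (cases "b \<in> V"; cases "Suc b \<in> U") (auto simp: height_Suc)
qed

text \<open>For a matched pair: \<open>h'\<close> is the path without the brackets at
  \<open>b\<close> and \<open>a\<close>, \<open>h\<close> the path with them. The raised points lie
  between two equally high ends, so none of them is a record or an exit, and a comparison with a
  raised point can be replaced by one with an end.\<close>

lemma plateau_bump:
  assumes "b < a"
    and h: "\<And>y. h y = h' y + of_bool (b < y \<and> y < a)"
    and const: "\<And>y. b \<le> y \<Longrightarrow> y \<le> a \<Longrightarrow> h' y = h' b"
  shows "exits h = exits h'" and "records h = records h'"
proof -
  have le: "h' x \<le> h x" for x by (simp add: h)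
  have outside: "h x = h' x" if "x \<le> b \<or> a \<le> x" for x using that by (auto simp: h)
  have inside: "h x = h b + 1" "h' x = h b" if "b < x" "x < a" for x
    using that const[of x] by (simp_all add: h)
  have ends: "h a = h b" "h' a = h b" "h' b = h b"
    using const[of a] assms(1) by (simp_all add: h)
  have "x \<in> exits h \<longleftrightarrow> x \<in> exits h'" for x
  proof (cases "b \<le> x \<and> x < a")
    case True
    then have "h b \<le> h x" "h' x = h b" using inside[of x] ends by (cases "x = b"; simp)+
    then have "\<not> h x < h a" "\<not> h' x < h' a" using ends by simp_all
    with True show ?thesis unfolding exits_def by blast
  next
    case False
    then have x: "h x = h' x" by (intro outside) auto
    show ?thesis
    proof
      assume *: "x \<in> exits h"
      have "h' x < h' y" if "x < y" for y
      proof (cases "b < y \<and> y < a")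
        case True
        with False that have "x < b" by simp
        with * have "h x < h b" by (simp add: exits_def)
        with True x show ?thesis by (simp add: inside)
      next
        case False
        then have "h y = h' y" by (intro outside) auto
        moreover have "h x < h y" using * that by (simp add: exits_def)
        ultimately show ?thesis using x by simp
      qed
      then show "x \<in> exits h'" by (simp add: exits_def)
    next
      assume "x \<in> exits h'"
      then show "x \<in> exits h" using x le unfolding exits_def by (auto intro: less_le_trans)
    qed
  qed
  then show "exits h = exits h'" by blast
  have "x \<in> records h \<longleftrightarrow> x \<in> records h'" for x
  proof (cases "b < x \<and> x \<le> a")
    case True
    then have "h b \<le> h x" "h' x = h b" using inside[of x] ends by (cases "x = a"; simp)+
    then have "\<not> h x < h b" "\<not> h' x < h' b" using ends by simp_all
    with True show ?thesis unfolding records_def by blast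
  next
    case False
    then have x: "h x = h' x" by (intro outside) auto
    show ?thesis
    proof
      assume *: "x \<in> records h"
      have "h' x < h' y" if "y < x" for y
      proof (cases "b < y \<and> y < a")
        case True
        with False that have "a < x" by simp
        with * have "h x < h a" by (simp add: records_def)
        with True x ends show ?thesis by (simp add: inside)
      next
        case False
        then have "h y = h' y" by (intro outside) auto
        moreover have "h x < h y" using * that by (simp add: records_def)
        ultimately show ?thesis using x by simp
      qed
      then show "x \<in> records h'" using * by (simp add: records_def)
    next
      assume "x \<in> records h'"
      then show "x \<in> records h" using x le unfolding records_def by (auto intro: less_le_trans)
    qed
  qed
  then show "records h = records h'" by blast
qed

text \<open>For an unmatched opening bracket at \<open>b\<close> with a plateau behind it: that
  whole plateau rises by one above \<open>b\<close>, so \<open>b\<close> becomes an exit, while no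
  point behind \<open>b\<close> is an exit or a record in either path.\<close>

lemma plateau_rise:
  assumes h: "\<And>y. h y = h' y + of_bool (b < y)"
    and const: "\<And>y. b \<le> y \<Longrightarrow> h' y = h' b"
  shows "exits h = insert b (exits h')" and "records h = records h'"
proof -
  have low: "h x = h' x" if "x \<le> b" for x using that by (simp add: h)
  have high: "h x = h' b + 1" if "b < x" for x using that const[of x] by (simp add: h)
  have "x \<in> exits h \<longleftrightarrow> x \<in> insert b (exits h')" for x
  proof -
    consider "x < b" | "x = b" | "b < x" by linarith
    then show ?thesis
    proof cases
      case 1
      have "h x < h y \<longleftrightarrow> h' x < h' y" if "y \<le> b" for y
        using that 1 by (simp add: low)
      moreover have "h x < h y" "h' x < h' y" if "h x < h b" "b < y" for y
        using that 1 const[of y] by (simp_all add: low high)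
      ultimately show ?thesis
        using 1 unfolding exits_def by simp (metis linorder_not_le order_refl)
    next
      case 2
      then show ?thesis by (simp add: exits_def low high)
    next
      case 3
      then have "\<not> h x < h (Suc x)" "\<not> h' x < h' (Suc x)"
        using const[of x] const[of "Suc x"] by (simp_all add: high)
      with 3 show ?thesis unfolding exits_def by auto
    qed
  qed
  then show "exits h = insert b (exits h')" by blast
  have "x \<in> records h \<longleftrightarrow> x \<in> records h'" for x
  proof (cases "x \<le> b")
    case True
    then show ?thesis by (simp add: records_def low)
  next
    case False
    then have "\<not> h x < h b" "\<not> h' x < h' b" using const[of x] by (simp_all add: high low)
    with False show ?thesis unfolding records_def by auto
  qed
  then show "records h = records h'" by blast
qed

text \<open>The recursion treats the largest opening bracket \<open>b\<close> first. All others lie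
  left of it, so without \<open>b\<close> and its partner the path is flat from \<open>b\<close> to
  that partner, or from \<open>b\<close> onwards if there is none; the two plateau lemmas describe
  the effect of restoring them.\<close>

lemma pairing_eq:
  assumes "sorted_wrt (>) bs" "finite A" "0 \<notin> A"
  shows "pairing bs A = (exits (height A (set bs)), records (height A (set bs)))"
  using assms
proof (induction bs arbitrary: A)
  case Nil
  have "records (height A {}) = A"
  proof
    show "A \<subseteq> records (height A {})"
    proof
      fix a assume a: "a \<in> A"
      have "height A {} a < height A {} x" if "x < a" for x
      proof -
        have "a \<in> A \<inter> {..a}" "a \<notin> A \<inter> {..x}" using a that by auto
        moreover have "A \<inter> {..x} \<subseteq> A \<inter> {..a}" using that by auto
        ultimately have "A \<inter> {..x} \<subset> A \<inter> {..a}" by blast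
        then show ?thesis by (simp add: height_def psubset_card_mono)
      qed
      with a Nil.prems show "a \<in> records (height A {})"
        by (auto simp: records_def intro: gr0I)
    qed
  qed (rule records_subset)
  then show ?case using exits_subset[of A "{}"] by simp
next
  case (Cons b bs)
  have b: "\<And>x. x \<in> set bs \<Longrightarrow> x < b" "b \<notin> set bs" and bs: "sorted_wrt (>) bs"
    using Cons.prems(1) by auto
  show ?case
  proof (cases "\<exists>a\<in>A. b < a")
    case True
    define a where "a = (LEAST a. a \<in> A \<and> b < a)"
    have a: "a \<in> A" "b < a" and least: "\<And>x. x \<in> A \<Longrightarrow> b < x \<Longrightarrow> a \<le> x"
      using True LeastI_ex[of "\<lambda>a. a \<in> A \<and> b < a"] Least_le[of "\<lambda>a. a \<in> A \<and> b < a"]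
      unfolding a_def by auto
    have h: "height A (set (b # bs)) y =
        height (A - {a}) (set bs) y + of_bool (b < y \<and> y < a)" for y
      using height_insert_left[of a "A - {a}" "set (b # bs)" y]
        height_insert_right[OF b(2), of "A - {a}" y] a
      by (auto simp: insert_absorb)
    have const: "height (A - {a}) (set bs) y = height (A - {a}) (set bs) b"
      if "b \<le> y" "y \<le> a" for y
    proof (rule height_const[OF _ that(1)])
      fix z assume "b \<le> z" "z < y"
      \<comment> \<open>Both sides are false: letters of \<open>bs\<close> are below
        \<open>b\<close>, and the only letter of \<open>A\<close> above \<open>b\<close> and up to
        \<open>a\<close> is the removed \<open>a\<close>.\<close>
      then show "z \<in> set bs \<longleftrightarrow> Suc z \<in> A - {a}"
        using b(1)[of z] least[of "Suc z"] that by auto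
    qed
    show ?thesis
      using True Cons.IH[OF bs, of "A - {a}"] Cons.prems plateau_bump[OF a(2) h const]
      by (simp add: a_def[symmetric])
  next
    case False
    have h: "height A (set (b # bs)) y = height A (set bs) y + of_bool (b < y)" for y
      using height_insert_right[OF b(2), of A y] by simp
    have const: "height A (set bs) y = height A (set bs) b" if "b \<le> y" for y
    proof (rule height_const[OF _ that])
      fix z assume "b \<le> z"
      then show "z \<in> set bs \<longleftrightarrow> Suc z \<in> A"
        using b(1)[of z] False by force
    qed
    show ?thesis
      using False Cons.IH[OF bs, of A] Cons.prems plateau_rise[OF h const]
      by (simp add: Let_def)
  qed
qed

lemma unpaired_eq:
  assumes "sorted_wrt (<) u" "sorted_wrt (<) v" "0 \<notin> set u"
  shows "unpaired_R u v = exits (height (set u) (set v))"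
    and "unpaired_L u v = records (height (set u) (set v))"
  using pairing_eq[of "rev v" "set u"] assms
  by (simp_all add: unpaired_R_def unpaired_L_def sorted_wrt_rev)

text \<open>Every pairing removes one letter from each side, so the difference of the sizes
  survives. It becomes the relation between string lengths and weight.\<close>

lemma card_pairing:
  assumes "finite A" "distinct bs"
  shows "finite (fst (pairing bs A)) \<and> finite (snd (pairing bs A)) \<and> fst (pairing bs A) \<subseteq> set bs \<and>
    int (card (snd (pairing bs A))) - int (card (fst (pairing bs A))) = int (card A) - int (length bs)"
  using assms
proof (induction bs arbitrary: A)
  case (Cons b bs)
  show ?case
  proof (cases "\<exists>a\<in>A. b < a")
    case True
    let ?a = "LEAST a. a \<in> A \<and> b < a"
    have "?a \<in> A" using True LeastI_ex[of "\<lambda>a. a \<in> A \<and> b < a"] by auto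
    then have "int (card (A - {?a})) = int (card A) - 1"
      using Cons.prems card_Suc_Diff1[of A ?a] by simp
    with True Cons.IH[of "A - {?a}"] Cons.prems show ?thesis by auto
  next
    case False
    obtain R L where RL: "pairing bs A = (R, L)" by force
    with Cons have "b \<notin> R" "finite R" by force+
    with False RL Cons.IH[of A] Cons.prems show ?thesis by (auto simp: Let_def)
  qed
qed simp

lemma card_unpaired:
  assumes "distinct u" "distinct v"
  shows "int (card (unpaired_L u v)) - int (card (unpaired_R u v)) = int (length u) - int (length v)"
  using card_pairing[of "set u" "rev v"] assms
  by (simp add: unpaired_L_def unpaired_R_def distinct_card)

section \<open>Moving a letter across the lowest run\<close>

lemma incr_word_eqI: "sorted_wrt (<) w \<Longrightarrow> set w = A \<Longrightarrow> incr_word A = w"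
  using strict_sorted_equal[of "incr_word A" w] by fastforce

lemma incr_word_block:
  assumes "finite A" "{c..<d} \<subseteq> A" "c \<le> d"
  shows "incr_word A = incr_word {x \<in> A. x < c} @ [c..<d] @ incr_word {x \<in> A. d \<le> x}"
  using assms by (intro incr_word_eqI) (fastforce simp: sorted_wrt_append)+

text \<open>The letters of \<open>u2\<close> are too high and those of \<open>v1\<close> too low to
  interact with the interval from \<open>c\<close> to \<open>c + s\<close> or with each other. They
  can be moved out from between the two inner words, which then stand side by side.\<close>

lemma word_perm_inner_cong:
  assumes "word_perm (A @ B) = word_perm (A' @ B')"
    and "set A \<subseteq> {c..c + s}" "set B \<subseteq> {c..c + s}" "set A' \<subseteq> {c..c + s}" "set B' \<subseteq> {c..c + s}"
    and far: "\<And>x. x \<in> set u2 \<Longrightarrow> c + s + 1 < x" and near: "\<And>x. x \<in> set v1 \<Longrightarrow> x + 1 < c"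
  shows "word_perm ((u1 @ A @ u2) @ (v1 @ B @ v2)) = word_perm ((u1 @ A' @ u2) @ (v1 @ B' @ v2))"
proof -
  have gather: "word_perm ((u1 @ A @ u2) @ (v1 @ B @ v2)) =
      word_perm (u1 @ v1) \<circ> word_perm (A @ B) \<circ> word_perm (u2 @ v2)"
    if "set A \<subseteq> {c..c + s}" "set B \<subseteq> {c..c + s}" for A B
  proof -
    have "word_perm (u2 @ (v1 @ B)) = word_perm ((v1 @ B) @ u2)"
      using far near that by (intro word_perm_commute) fastforce
    then have "word_perm ((u1 @ A @ u2) @ (v1 @ B @ v2)) =
        word_perm u1 \<circ> word_perm (A @ v1) \<circ> word_perm (B @ u2 @ v2)"
      by (metis append.assoc word_perm_append)
    also have "word_perm (A @ v1) = word_perm (v1 @ A)"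
      using near that by (intro word_perm_commute) fastforce
    finally show ?thesis by (simp only: word_perm_append comp_assoc)
  qed
  show ?thesis
    by (simp only: gather assms(1-5))
qed

text \<open>The gaps at \<open>Suc (c + s)\<close> in \<open>U\<close> and at \<open>c - 1\<close>
  in \<open>V\<close> isolate the two runs, so that the staircase relation applies to them
  alone.\<close>

lemma word_perm_block_exchange:
  assumes "finite U" "finite V" "{c..c + s} \<subseteq> U" "{c..<c + s} \<subseteq> V" "0 < c"
    and "c + s \<notin> V" "Suc (c + s) \<notin> U" "c - 1 \<notin> V"
  shows "word_perm (incr_word U @ incr_word V) =
    word_perm (incr_word (U - {c}) @ incr_word (insert (c + s) V))"
proof -
  let ?u1 = "incr_word {x \<in> U. x < c}" and ?u2 = "incr_word {x \<in> U. c + s + 1 \<le> x}"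
  let ?v1 = "incr_word {x \<in> V. x < c}" and ?v2 = "incr_word {x \<in> V. c + s + 1 \<le> x}"
  have u: "incr_word U = ?u1 @ [c..<c + s + 1] @ ?u2"
    using assms by (intro incr_word_block) auto
  have "{x \<in> U - {c}. x < c + 1} = {x \<in> U. x < c}" "{x \<in> U - {c}. c + s + 1 \<le> x} = {x \<in> U. c + s + 1 \<le> x}"
    by auto
  then have u': "incr_word (U - {c}) = ?u1 @ [c + 1..<c + s + 1] @ ?u2"
    using incr_word_block[of "U - {c}" "c + 1" "c + s + 1"] assms by force
  have "{x \<in> V. c + s \<le> x} = {x \<in> V. c + s + 1 \<le> x}"
    using assms(6) by (auto simp: Suc_le_eq le_less)
  then have v: "incr_word V = ?v1 @ [c..<c + s] @ ?v2"
    using incr_word_block[of V c "c + s"] assms by simp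
  have "{x \<in> insert (c + s) V. x < c} = {x \<in> V. x < c}"
      "{x \<in> insert (c + s) V. c + s + 1 \<le> x} = {x \<in> V. c + s + 1 \<le> x}"
    by auto
  moreover have "{c..<c + s + 1} \<subseteq> insert (c + s) V" using assms(4) by (force simp: less_Suc_eq)
  ultimately have v': "incr_word (insert (c + s) V) = ?v1 @ [c..<c + s + 1] @ ?v2"
    using incr_word_block[of "insert (c + s) V" c "c + s + 1"] assms(2) by simp
  have far: "c + s + 1 < x" if "x \<in> set ?u2" for x
    using that assms by (cases "x = Suc (c + s)") auto
  have near: "x + 1 < c" if "x \<in> set ?v1" for x
    using that assms by (cases "x = c - 1") auto
  show ?thesis
    unfolding u v u' v'
    by (rule word_perm_inner_cong[OF word_perm_staircase _ _ _ _ far near]) auto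
qed

text \<open>The situation excluded by minimality.\<close>

lemma word_perm_block_cancel:
  assumes "finite U" "finite V" "{c..c + s} \<subseteq> U" "{c..c + s} \<subseteq> V" "0 < c"
    and "Suc (c + s) \<notin> U" "c - 1 \<notin> V"
  shows "word_perm (incr_word U @ incr_word V) =
    word_perm (incr_word (U - {c}) @ incr_word (V - {c + s}))"
proof -
  let ?u1 = "incr_word {x \<in> U. x < c}" and ?u2 = "incr_word {x \<in> U. c + s + 1 \<le> x}"
  let ?v1 = "incr_word {x \<in> V. x < c}" and ?v2 = "incr_word {x \<in> V. c + s + 1 \<le> x}"
  have u: "incr_word U = ?u1 @ [c..<c + s + 1] @ ?u2"
    using assms by (intro incr_word_block) auto
  have "{x \<in> U - {c}. x < c + 1} = {x \<in> U. x < c}" "{x \<in> U - {c}. c + s + 1 \<le> x} = {x \<in> U. c + s + 1 \<le> x}"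
    by auto
  then have u': "incr_word (U - {c}) = ?u1 @ [c + 1..<c + s + 1] @ ?u2"
    using incr_word_block[of "U - {c}" "c + 1" "c + s + 1"] assms by force
  have v: "incr_word V = ?v1 @ [c..<c + s + 1] @ ?v2"
    using assms by (intro incr_word_block) auto
  have "{x \<in> V - {c + s}. x < c} = {x \<in> V. x < c}"
      "{x \<in> V - {c + s}. c + s \<le> x} = {x \<in> V. c + s + 1 \<le> x}"
    by (auto simp: Suc_le_eq le_less)
  moreover have "{c..<c + s} \<subseteq> V - {c + s}" using assms(4) by auto
  ultimately have v': "incr_word (V - {c + s}) = ?v1 @ [c..<c + s] @ ?v2"
    using incr_word_block[of "V - {c + s}" c "c + s"] assms(2) by simp
  have far: "c + s + 1 < x" if "x \<in> set ?u2" for x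
    using that assms by (cases "x = Suc (c + s)") auto
  have near: "x + 1 < c" if "x \<in> set ?v1" for x
    using that assms by (cases "x = c - 1") auto
  \<comment> \<open>The second run is the shorter one followed by \<open>c + s\<close>; the
    staircase relation produces another \<open>c + s\<close> just before that letter, and the two
    cancel.\<close>
  have "word_perm ([c..<c + s + 1] @ [c..<c + s + 1]) =
      word_perm ([c..<c + s + 1] @ [c..<c + s]) \<circ> simple_transp (c + s)"
    by (simp add: word_perm_append word_perm_Cons comp_assoc)
  also have "\<dots> = word_perm [c + 1..<c + s + 1] \<circ> word_perm [c..<c + s] \<circ>
      (simple_transp (c + s) \<circ> simple_transp (c + s))"
    unfolding word_perm_staircase by (simp add: word_perm_append word_perm_Cons comp_assoc del: simple_transp_involutory)
  finally have "word_perm ([c..<c + s + 1] @ [c..<c + s + 1]) =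
      word_perm ([c + 1..<c + s + 1] @ [c..<c + s])"
    by (simp add: word_perm_append)
  then show ?thesis
    unfolding u v u' v'
    by (rule word_perm_inner_cong[OF _ _ _ _ _ far near]) auto
qed

text \<open>
  The run \<open>c, \<dots>, c + s\<close> lies where \<open>height U V\<close> first attains its minimum. Moving its letter
  from \<open>U\<close> to \<open>V\<close> lifts the minimum by one, and \<open>c + s\<close> becomes the last place where it is attained.
\<close>

definition lowest_run :: "nat set \<Rightarrow> nat set \<Rightarrow> nat \<Rightarrow> nat \<Rightarrow> bool" where
  "lowest_run U V c s \<longleftrightarrow>
     finite U \<and> finite V \<and> 0 \<notin> V \<and> 0 < c \<and> {c..c + s} \<subseteq> U \<and> {c..<c + s} \<subseteq> V \<and>
     c + s \<notin> V \<and> Suc (c + s) \<notin> U \<and> c - 1 \<notin> V \<and>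
     (\<forall>x<c. height U V c < height U V x) \<and> (\<forall>x. height U V c \<le> height U V x)"

section \<open>Locating the lowest run\<close>

lemma ex_height_min:
  assumes "finite U"
  shows "\<exists>a. \<forall>x. height U V a \<le> height U V x"
proof -
  \<comment> \<open>Shifting by \<open>card U\<close> makes the heights nonnegative, so a least
    value exists among the natural numbers.\<close>
  obtain a where a: "\<And>x. nat (height U V a + int (card U)) \<le> nat (height U V x + int (card U))"
    using ex_has_least_nat[of "\<lambda>_. True" 0 "\<lambda>x. nat (height U V x + int (card U))"] by auto
  have "height U V a \<le> height U V x" for x
    using a[of x] height_lower_bound[OF assms, of V] by (smt (verit) nat_le_eq_zle)
  then show ?thesis by blast
qed

text \<open>The largest record is the first point of minimal height. From there the path cannot
  fall, so each further letter \<open>c + j + 1\<close> of the run in \<open>U\<close> forces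
  \<open>c + j\<close> into \<open>V\<close>. That \<open>c + s\<close> is not in \<open>V\<close>
  does not follow from the path; minimality of the word will supply it.\<close>

lemma run_of_record:
  assumes "finite U" "finite V" "0 \<notin> V" "records (height U V) \<noteq> {}"
    and c_def: "c = Max (records (height U V))" and s_def: "s = (LEAST j. c + j + 1 \<notin> U)"
  shows "{c..c + s} \<subseteq> U" "{c..<c + s} \<subseteq> V" "Suc (c + s) \<notin> U" "c - 1 \<notin> V" "0 < c"
    and "c + s \<notin> V \<Longrightarrow> lowest_run U V c s"
proof -
  let ?h = "height U V"
  have fin: "finite (records ?h)" using assms(1) records_subset finite_subset by blast
  have c: "c \<in> records ?h" unfolding c_def using fin assms(4) by (rule Max_in)
  then have first: "\<forall>x<c. ?h c < ?h x" by (simp add: records_def)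
  from c show pos: "0 < c" by (simp add: records_def)
  have low: "?h c \<le> ?h x" for x
  proof -
    \<comment> \<open>The first point of minimal height is 0 or a record, hence at most
      \<open>c\<close>; since \<open>c\<close> is a record, it cannot be smaller.\<close>
    define a where "a = (LEAST a. \<forall>x. ?h a \<le> ?h x)"
    have a: "\<And>x. ?h a \<le> ?h x"
      using LeastI_ex[OF ex_height_min[OF assms(1), of V]] unfolding a_def by blast
    have "?h a < ?h x" if "x < a" for x
      using not_less_Least[OF that[unfolded a_def]] a by (meson leI order_trans)
    then have "a = 0 \<or> a \<in> records ?h" by (auto simp: records_def)
    then have "a \<le> c" using Max_ge[OF fin] unfolding c_def by auto
    then have "a = c" using first a[of c] by (meson le_neq_implies_less leD)
    then show ?thesis using a by simp
  qed
  \<comment> \<open>A number beyond a bound of \<open>U\<close> shows that the minimum defining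
    \<open>s\<close> is attained.\<close>
  obtain N where "\<forall>x\<in>U. x < N" using assms(1) finite_nat_set_iff_bounded by blast
  then have "c + N + 1 \<notin> U" by auto
  then have "c + s + 1 \<notin> U" unfolding s_def by (rule LeastI)
  then show end_run: "Suc (c + s) \<notin> U" by simp
  have inU: "c + j + 1 \<in> U" if "j < s" for j
    using not_less_Least[OF that[unfolded s_def]] by simp
  have "c \<in> U" using c records_subset by blast
  moreover have "x \<in> U" if "c < x" "x \<le> c + s" for x
    using inU[of "x - c - 1"] that by simp
  ultimately show run_U: "{c..c + s} \<subseteq> U"
    by (force simp: le_less)
  have run: "?h (c + j) = ?h c" if "j \<le> s" for j
    using that
  proof (induction j)
    case (Suc j)
    then show ?case using inU[of j] low[of "c + Suc j"] height_Suc[of U V "c + j"]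
      by (cases "c + j \<in> V") auto
  qed simp
  have "c + j \<in> V" if "j < s" for j
    using run[of j] run[of "Suc j"] that inU[of j] height_Suc[of U V "c + j"]
    by (cases "c + j \<in> V") auto
  then show run_V: "{c..<c + s} \<subseteq> V"
    by (metis atLeastLessThan_iff le_Suc_ex nat_add_left_cancel_less subsetI)
  show below: "c - 1 \<notin> V"
    using first[rule_format, of "c - 1"] pos height_Suc[of U V "c - 1"] \<open>c \<in> U\<close> by auto
  show "lowest_run U V c s" if "c + s \<notin> V"
    using assms pos run_U run_V end_run below first low that by (simp add: lowest_run_def)
qed

text \<open>The mirror image: the smallest exit is the last point of minimal height, and the run is
  followed to the left. The conclusion concerns the sets before the move, which
  \<open>e_even\<close> has to reconstruct; that \<open>c - t\<close> is not in \<open>U\<close>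
  again has to come from minimality.\<close>

lemma run_of_exit:
  assumes "finite U" "finite V" "0 \<notin> V" "exits (height U V) \<noteq> {}"
    and c_def: "c = Min (exits (height U V))" and t_def: "t = (LEAST j. c - j - 1 \<notin> V)"
  shows "t < c" "{c - t<..c} \<subseteq> U" "{c - t..c} \<subseteq> V" "Suc c \<notin> U" "c - t - 1 \<notin> V"
    and "c - t \<notin> U \<Longrightarrow> lowest_run (insert (c - t) U) (V - {c}) (c - t) t"
proof -
  let ?h = "height U V"
  have fin: "finite (exits ?h)" using assms(2) exits_subset finite_subset by blast
  have c: "c \<in> exits ?h" unfolding c_def using fin assms(4) by (rule Min_in)
  then have last: "\<And>y. c < y \<Longrightarrow> ?h c < ?h y" by (auto simp: exits_def)
  have low: "?h c \<le> ?h x" for x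
  proof -
    \<comment> \<open>The points of minimal height are bounded by the exit \<open>c\<close>, and the
      last of them is itself an exit.\<close>
    define M where "M = {a. \<forall>x. ?h a \<le> ?h x}"
    have "a \<le> c" if "a \<in> M" for a
    proof (rule ccontr)
      assume "\<not> a \<le> c"
      then have "?h c < ?h a" by (intro last) simp
      with that show False by (simp add: M_def) (meson leD)
    qed
    then have "finite M" using finite_nat_set_iff_bounded_le by blast
    moreover have "M \<noteq> {}" using ex_height_min[OF assms(1), of V] by (auto simp: M_def)
    ultimately have a: "Max M \<in> M" and max: "\<And>y. y \<in> M \<Longrightarrow> y \<le> Max M" by auto
    have "?h (Max M) < ?h y" if "Max M < y" for y
    proof (rule ccontr)
      assume "\<not> ?thesis"
      with a have "y \<in> M" by (auto simp: M_def not_less intro: order_trans)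
      with max that show False by (meson leD)
    qed
    then have "Max M \<in> exits ?h" by (simp add: exits_def)
    then have "c \<le> Max M" unfolding c_def using fin by auto
    with \<open>Max M \<in> M\<close> \<open>\<And>a. a \<in> M \<Longrightarrow> a \<le> c\<close> have "c \<in> M" by (metis le_antisym)
    then show ?thesis by (simp add: M_def)
  qed
  have "c \<in> V" using c exits_subset by blast
  then have pos: "0 < c" using assms(3) by (auto intro: gr0I)
  have inV: "c - j - 1 \<in> V" if "j < t" for j
    using not_less_Least[OF that[unfolded t_def]] by simp
  \<comment> \<open>Otherwise the descent from \<open>c\<close> through \<open>V\<close> would reach
    0.\<close>
  show t: "t < c"
    using inV[of "c - 1"] assms(3) pos by (force simp: not_less)
  have "c - c - 1 \<notin> V" using assms(3) by simp
  then show below: "c - t - 1 \<notin> V" unfolding t_def by (rule LeastI)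
  have run: "?h (c - j) = ?h c" if "j \<le> t" for j
    using that
  proof (induction j)
    case (Suc j)
    then have "Suc (c - Suc j) = c - j" using t by simp
    then show ?case using Suc inV[of j] low[of "c - Suc j"] height_Suc[of U V "c - Suc j"]
      by (cases "c - j \<in> U") auto
  qed simp
  have inU: "c - j \<in> U" if "j < t" for j
  proof -
    have "Suc (c - Suc j) = c - j" using t that by simp
    then show ?thesis
      using run[of j] run[of "Suc j"] that inV[of j] height_Suc[of U V "c - Suc j"]
      by (cases "c - j \<in> U") auto
  qed
  show run_U: "{c - t<..c} \<subseteq> U"
  proof
    fix x assume "x \<in> {c - t<..c}"
    then have "c - (c - x) = x" "c - x < t" using t by auto
    then show "x \<in> U" using inU[of "c - x"] by simp
  qed
  show run_V: "{c - t..c} \<subseteq> V"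
  proof
    fix x assume x: "x \<in> {c - t..c}"
    show "x \<in> V"
    proof (cases "x = c")
      case False
      then have "c - (c - x - 1) - 1 = x" "c - x - 1 < t" using t x by auto
      then show ?thesis using inV[of "c - x - 1"] by simp
    qed (simp add: \<open>c \<in> V\<close>)
  qed
  show end_run: "Suc c \<notin> U"
    using last[of "Suc c"] height_Suc[of U V c] \<open>c \<in> V\<close> by auto
  show "lowest_run (insert (c - t) U) (V - {c}) (c - t) t" if "c - t \<notin> U"
  proof -
    let ?g = "height (insert (c - t) U) (V - {c})"
    have g: "?g y = ?h y - of_bool (c - t \<le> y) - of_bool (c < y)" for y
      using height_insert_left[OF that, of "V - {c}" y] height_insert_right[of c "V - {c}" U y] \<open>c \<in> V\<close>
      by (simp add: insert_absorb)
    \<comment> \<open>Undoing the move lowers the path by one from \<open>c - t\<close> to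
      \<open>c\<close> and by two beyond, where the exit \<open>c\<close> leaves a margin of one. So
      the minimum drops by one and is first attained at \<open>c - t\<close>.\<close>
    have gd: "?g (c - t) = ?h c - 1" using run[of t] by (simp add: g)
    have "?g (c - t) < ?g x" if "x < c - t" for x
      using that low[of x] t unfolding gd by (auto simp: g)
    moreover have "?g (c - t) \<le> ?g x" for x
      using low[of x] last[of x] unfolding gd by (auto simp: g)
    moreover have "{c - t..c} \<subseteq> insert (c - t) U"
      using run_U by (auto simp: le_less)
    moreover have "{c - t..<c} \<subseteq> V - {c}"
      using run_V by auto
    ultimately show ?thesis
      using assms(1-3) t end_run below
      by (simp add: lowest_run_def)
  qed
qed

text \<open>The move leaves the path unchanged before \<open>c\<close>, raises it by one on the run
  and by two after it. So records before \<open>c\<close> and exits after \<open>c + s\<close>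
  persist, \<open>c\<close> is lost as a record and \<open>c + s\<close> is gained as an
  exit.\<close>

lemma lowest_run_step:
  assumes "lowest_run U V c s"
  defines "U' \<equiv> U - {c}" and "V' \<equiv> insert (c + s) V"
  shows "records (height U V) = insert c (records (height U' V'))" "c \<notin> records (height U' V')"
    and "exits (height U' V') = insert (c + s) (exits (height U V))" "c + s \<notin> exits (height U V)"
    and "Max (records (height U V)) = c" "(LEAST j. c + j + 1 \<notin> U) = s"
    and "Min (exits (height U' V')) = c + s" "(LEAST j. c + s - j - 1 \<notin> V') = s"
    and "word_perm (incr_word U @ incr_word V) = word_perm (incr_word U' @ incr_word V')"
proof -
  let ?h = "height U V" and ?g = "height U' V'"
  have fin: "finite U" "finite V" and pos: "0 < c" "0 \<notin> V"
    and run: "{c..c + s} \<subseteq> U" "{c..<c + s} \<subseteq> V"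
    and stop: "c + s \<notin> V" "Suc (c + s) \<notin> U" "c - 1 \<notin> V"
    and first: "\<And>x. x < c \<Longrightarrow> ?h c < ?h x" and low: "\<And>x. ?h c \<le> ?h x"
    using assms(1) by (auto simp: lowest_run_def)
  have "c \<in> U" using run by auto
  have g: "?g y = ?h y + of_bool (c \<le> y) + of_bool (c + s < y)" for y
    using height_insert_left[of c U' V' y] height_insert_right[OF stop(1), of U y] \<open>c \<in> U\<close>
    by (simp add: U'_def V'_def insert_absorb)
  have const: "?h y = ?h c" if "c \<le> y" "y \<le> c + s" for y
    using that(2) by (intro height_const that(1)) (use run in \<open>auto simp: subset_iff\<close>)
  have gl: "?g y = ?h y" if "y < c" for y using that by (simp add: g)
  have gm: "?g y = ?h c + 1" if "c \<le> y" "y \<le> c + s" for y using that const[of y] by (simp add: g)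
  have gr: "?g y = ?h y + 2" if "c + s < y" for y using that by (simp add: g)
  have glow: "?h c + 1 \<le> ?g y" for y
    using first[of y] low[of y] by (cases "c \<le> y") (auto simp: g)
  have rec_h: "x \<le> c" if "x \<in> records ?h" for x
  proof (rule ccontr)
    assume "\<not> x \<le> c"
    with that have "?h x < ?h c" by (simp add: records_def)
    with low[of x] show False by simp
  qed
  have rec_g: "x < c" if "x \<in> records ?g" for x
  proof (rule ccontr)
    assume "\<not> x < c"
    \<comment> \<open>The point \<open>c - 1\<close> is already as low as the new minimum, so no new
      record lies at \<open>c\<close> or later.\<close>
    have "?h (c - 1) = ?h c + 1"
      using height_Suc[of U V "c - 1"] pos(1) \<open>c \<in> U\<close> stop(3) by simp
    then have "?g (c - 1) = ?h c + 1" using gl[of "c - 1"] pos(1) by simp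
    moreover have "?g x < ?g (c - 1)"
      using that pos(1) \<open>\<not> x < c\<close> by (auto simp: records_def)
    ultimately show False using glow[of x] by simp
  qed
  show rec: "records ?h = insert c (records ?g)"
  proof (intro set_eqI)
    fix x
    consider "x < c" | "x = c" | "c < x" by linarith
    then show "x \<in> records ?h \<longleftrightarrow> x \<in> insert c (records ?g)"
    proof cases
      case 1
      then show ?thesis by (simp add: records_def gl)
    next
      case 2
      then show ?thesis using pos(1) first by (simp add: records_def)
    next
      case 3
      then show ?thesis using rec_h[of x] rec_g[of x] by auto
    qed
  qed
  show "c \<notin> records ?g" using rec_g by blast
  have ex_g: "c + s \<le> x" if "x \<in> exits ?g" for x
  proof (rule ccontr)
    assume "\<not> c + s \<le> x"
    then have "?g x < ?g (c + s)" using that by (simp add: exits_def)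
    then show False using glow[of x] gm[of "c + s"] by simp
  qed
  have ex_h: "c + s < x" if "x \<in> exits ?h" for x
  proof (rule ccontr)
    assume "\<not> c + s < x"
    then have "?h x < ?h (Suc (c + s))" using that by (simp add: exits_def)
    \<comment> \<open>Before the move the minimum is attained again just behind the run, so no exit
      lies at or before \<open>c + s\<close>.\<close>
    moreover have "?h (Suc (c + s)) = ?h c"
      using height_Suc[of U V "c + s"] stop const[of "c + s"] by simp
    ultimately show False using low[of x] by simp
  qed
  show ex: "exits ?g = insert (c + s) (exits ?h)"
  proof (intro set_eqI)
    fix x
    consider "x < c + s" | "x = c + s" | "c + s < x" by linarith
    then show "x \<in> exits ?g \<longleftrightarrow> x \<in> insert (c + s) (exits ?h)"
    proof cases
      case 1
      then show ?thesis using ex_g[of x] ex_h[of x] by auto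
    next
      case 2
      have "?g (c + s) < ?g y" if "c + s < y" for y
        using that low[of y] gm[of "c + s"] gr[of y] by simp
      with 2 show ?thesis by (simp add: exits_def)
    next
      case 3
      then show ?thesis by (simp add: exits_def gr)
    qed
  qed
  show "c + s \<notin> exits ?h" using ex_h by blast
  have "finite (records ?h)" by (rule finite_subset[OF records_subset fin(1)])
  then show "Max (records ?h) = c" using rec_h rec by (intro Max_eqI) auto
  have "finite (exits ?g)" by (rule finite_subset[OF exits_subset]) (simp add: V'_def fin)
  then show "Min (exits ?g) = c + s" using ex_g ex by (intro Min_eqI) auto
  show "(LEAST j. c + j + 1 \<notin> U) = s"
  proof (rule Least_equality)
    show "c + s + 1 \<notin> U" using stop(2) by simp
    fix j assume "c + j + 1 \<notin> U"
    moreover have "c + j + 1 \<in> U" if "j < s" using run(1) that by force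
    ultimately show "s \<le> j" by (meson not_le)
  qed
  show "(LEAST j. c + s - j - 1 \<notin> V') = s"
  proof (rule Least_equality)
    show "c + s - s - 1 \<notin> V'" using stop pos by (auto simp: V'_def)
    fix j assume "c + s - j - 1 \<notin> V'"
    moreover have "c + s - j - 1 \<in> V'" if "j < s"
    proof -
      have "c + s - j - 1 \<in> {c..<c + s}" using that by auto
      then show ?thesis using run(2) by (auto simp: V'_def)
    qed
    ultimately show "s \<le> j" by (meson not_le)
  qed
  show "word_perm (incr_word U @ incr_word V) = word_perm (incr_word U' @ incr_word V')"
    unfolding U'_def V'_def by (rule word_perm_block_exchange) (fact fin run pos stop)+
qed

section \<open>Even operators\<close>

lemma split_pair:
  assumes "Suc k < length ws"
  shows "ws = take k ws @ ws ! k # ws ! Suc k # drop (Suc (Suc k)) ws"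
  using assms by (metis Cons_nth_drop_Suc Suc_lessD id_take_nth_drop)

lemma update_pair:
  assumes "Suc k < length ws"
  shows "ws[k := u, Suc k := v] = take k ws @ u # v # drop (Suc (Suc k)) ws"
proof -
  have "(take k ws @ ws ! k # ws ! Suc k # drop (Suc (Suc k)) ws)[k := u, Suc k := v] =
      take k ws @ u # v # drop (Suc (Suc k)) ws"
    using assms by (simp add: list_update_append)
  then show ?thesis using split_pair[OF assms] by simp
qed

lemma lookup_rf_wt:
  "Poly_Mapping.lookup (rf_wt ws) j = (if 1 \<le> j \<and> j \<le> length ws then int (length (ws ! (j - 1))) else 0)"
  unfolding rf_wt_def
  by (subst lookup_sum) (auto simp: lookup_single when_def)

lemma rf_wt_step:
  assumes "1 \<le> i" "i < length ws"
    and "length (ws ! (i - 1)) = Suc (length u)" "length v = Suc (length (ws ! i))"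
  shows "rf_wt (ws[i - 1 := u, i := v]) = rf_wt ws - simple_root i"
proof (rule poly_mapping_eqI)
  fix j
  show "Poly_Mapping.lookup (rf_wt (ws[i - 1 := u, i := v])) j =
      Poly_Mapping.lookup (rf_wt ws - simple_root i) j"
    using assms
    by (cases "j = i"; cases "j = i + 1")
      (auto simp: lookup_rf_wt lookup_minus simple_root_def lookup_single when_def nth_list_update)
qed

lemma RF_blocks:
  assumes "ws \<in> RF_fpf m z" "k < m"
  shows "sorted_wrt (<) (ws ! k)" "0 \<notin> set (ws ! k)" "incr_word (set (ws ! k)) = ws ! k"
    "card (set (ws ! k)) = length (ws ! k)"
proof -
  have k: "ws ! k \<in> set ws" using assms by (simp add: RF_fpf_def)
  then show s: "sorted_wrt (<) (ws ! k)" using assms(1) by (simp add: RF_fpf_def)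
  show "0 \<notin> set (ws ! k)"
    using assms(1) k fpf_words_pos by (fastforce simp: RF_fpf_def)
  show "incr_word (set (ws ! k)) = ws ! k" using s by (rule incr_word_eqI) simp
  show "card (set (ws ! k)) = length (ws ! k)"
    using s by (simp add: distinct_card strict_sorted_iff)
qed

text \<open>Minimality is used in two ways: the inequality will refute cancelling runs, and the case
  of equal lengths gives closure under the operators.\<close>

lemma RF_exchange:
  assumes "ws \<in> RF_fpf m z" "Suc k < m" "0 \<notin> set u" "0 \<notin> set v"
    and "word_perm (u @ v) = word_perm (ws ! k @ ws ! Suc k)"
  shows "length (ws ! k) + length (ws ! Suc k) \<le> length u + length v"
    and "sorted_wrt (<) u \<Longrightarrow> sorted_wrt (<) v \<Longrightarrow>
      length (ws ! k) + length (ws ! Suc k) = length u + length v \<Longrightarrow>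
      ws[k := u, Suc k := v] \<in> RF_fpf m z"
proof -
  let ?x = "concat (take k ws)" and ?y = "concat (drop (Suc (Suc k)) ws)"
  let ?w = "?x @ (u @ v) @ ?y"
  have len: "Suc k < length ws" using assms by (simp add: RF_fpf_def)
  have old: "concat ws = ?x @ (ws ! k @ ws ! Suc k) @ ?y"
    by (subst split_pair[OF len]) simp
  have new: "concat (ws[k := u, Suc k := v]) = ?w"
    by (simp add: update_pair[OF len])
  have word: "concat ws \<in> fpf_involution_words z" using assms(1) by (simp add: RF_fpf_def)
  have tw: "twist ?w = twist (concat ws)"
    unfolding old by (intro twist_cong word_perm_append_cong refl assms(5))
  have pos: "0 \<notin> set ?w" using fpf_words_pos[OF word] assms(3,4) unfolding old by auto
  show "length (ws ! k) + length (ws ! Suc k) \<le> length u + length v"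
    using fpf_words_minimal[OF word tw pos] unfolding old by simp
  assume "sorted_wrt (<) u" "sorted_wrt (<) v"
    and eq: "length (ws ! k) + length (ws ! Suc k) = length u + length v"
  moreover have "?w \<in> fpf_involution_words z"
    using eq by (intro fpf_words_cong[OF word tw pos]) (simp add: old)
  moreover have "set (ws[k := u, Suc k := v]) \<subseteq> insert v (insert u (set ws))"
    by (auto dest!: subsetD[OF set_update_subset_insert])
  ultimately show "ws[k := u, Suc k := v] \<in> RF_fpf m z"
    using assms(1) new unfolding RF_fpf_def by auto
qed

text \<open>One relation for both operators: \<open>f_even\<close> follows a step forwards and
  \<open>e_even\<close> backwards, which makes them mutually inverse.\<close>

definition even_step :: "nat \<Rightarrow> nat list list \<Rightarrow> nat list list \<Rightarrow> bool" where
  "even_step i ws ws' \<longleftrightarrow> (\<exists>c s. lowest_run (set (ws ! (i - 1))) (set (ws ! i)) c s \<and>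
     ws' = ws[i - 1 := incr_word (set (ws ! (i - 1)) - {c}), i := incr_word (insert (c + s) (set (ws ! i)))])"

text \<open>\<open>phi\<close> and \<open>eps\<close> are the expected string lengths;
  \<open>string_set_f_even\<close> and \<open>string_set_e_even\<close> confirm them.\<close>

definition phi :: "nat \<Rightarrow> nat list list \<Rightarrow> nat" where
  "phi i ws = card (unpaired_L (ws ! (i - 1)) (ws ! i))"

definition eps :: "nat \<Rightarrow> nat list list \<Rightarrow> nat" where
  "eps i ws = card (unpaired_R (ws ! (i - 1)) (ws ! i))"

lemma RF_unpaired:
  assumes "ws \<in> RF_fpf m z" "1 \<le> i" "i < m"
  shows "unpaired_R (ws ! (i - 1)) (ws ! i) = exits (height (set (ws ! (i - 1))) (set (ws ! i)))"
    and "unpaired_L (ws ! (i - 1)) (ws ! i) = records (height (set (ws ! (i - 1))) (set (ws ! i)))"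
  using assms RF_blocks[OF assms(1), of "i - 1"] RF_blocks[OF assms(1), of i]
  by (intro unpaired_eq; simp)+

lemma finite_unpaired:
  assumes "ws \<in> RF_fpf m z" "1 \<le> i" "i < m"
  shows "finite (unpaired_L (ws ! (i - 1)) (ws ! i))" "finite (unpaired_R (ws ! (i - 1)) (ws ! i))"
  unfolding RF_unpaired[OF assms]
  by (rule finite_subset[OF records_subset List.finite_set], rule finite_subset[OF exits_subset List.finite_set])

lemma even_step_RF:
  assumes "ws \<in> RF_fpf m z" "1 \<le> i" "i < m" "even_step i ws ws'"
  shows "ws' \<in> RF_fpf m z" "f_even i ws = Some ws'" "e_even i ws' = Some ws"
    "phi i ws = Suc (phi i ws')" "eps i ws' = Suc (eps i ws)" "rf_wt ws' = rf_wt ws - simple_root i"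
proof -
  let ?u = "ws ! (i - 1)" and ?v = "ws ! i"
  obtain c s where run: "lowest_run (set ?u) (set ?v) c s"
    and ws': "ws' = ws[i - 1 := incr_word (set ?u - {c}), i := incr_word (insert (c + s) (set ?v))]"
    using assms(4) by (auto simp: even_step_def)
  have len: "length ws = m" using assms(1) by (simp add: RF_fpf_def)
  have i: "Suc (i - 1) = i" using assms(2) by simp
  have c: "c \<in> set ?u" "c + s \<notin> set ?v" "0 < c" using run by (auto simp: lowest_run_def)
  note u = RF_blocks[OF assms(1), of "i - 1"] and v = RF_blocks[OF assms(1), of i]
  have pos: "0 \<notin> set ?u" "0 \<notin> set ?v" using u v assms by auto
  have iw: "incr_word (set ?u) = ?u" "incr_word (set ?v) = ?v" using u v assms by auto
  have cards: "card (set ?u) = length ?u" "card (set ?v) = length ?v" using u v assms by auto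
  note step = lowest_run_step[OF run]
  define u' v' where "u' = incr_word (set ?u - {c})" and "v' = incr_word (insert (c + s) (set ?v))"
  have u': "set u' = set ?u - {c}" "sorted_wrt (<) u'" and v': "set v' = insert (c + s) (set ?v)" "sorted_wrt (<) v'"
    unfolding u'_def v'_def by (simp_all only: set_sorted_list_of_set finite_Diff finite_insert List.finite_set
        strict_sorted_list_of_set)
  have lens: "length ?u = Suc (length u')" "length v' = Suc (length ?v)"
    using c cards card_Suc_Diff1[of "set ?u" c] by (simp_all add: u'_def v'_def)
  have ws'_nth: "ws' ! (i - 1) = u'" "ws' ! i = v'"
    using assms(2,3) len by (simp_all add: ws' u'_def v'_def nth_list_update)
  have "ws[i - 1 := u', Suc (i - 1) := v'] \<in> RF_fpf m z"
  proof (rule RF_exchange(2)[OF assms(1)])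
    show "word_perm (u' @ v') = word_perm (ws ! (i - 1) @ ws ! Suc (i - 1))"
      unfolding i u'_def v'_def using step(9)[unfolded iw] by (rule sym)
    show "length (ws ! (i - 1)) + length (ws ! Suc (i - 1)) = length u' + length v'"
      unfolding i using lens by linarith
  qed (use assms(2,3) pos c u' v' in auto)
  then show RF': "ws' \<in> RF_fpf m z" unfolding ws' u'_def v'_def i .
  note sets = u'(1)[folded ws'_nth] v'(1)[folded ws'_nth]
  have recs: "unpaired_L ?u ?v = insert c (unpaired_L (ws' ! (i - 1)) (ws' ! i))"
    "c \<notin> unpaired_L (ws' ! (i - 1)) (ws' ! i)"
    unfolding RF_unpaired[OF assms(1-3)] RF_unpaired[OF RF' assms(2,3)] sets by (fact step)+
  have exs: "unpaired_R (ws' ! (i - 1)) (ws' ! i) = insert (c + s) (unpaired_R ?u ?v)"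
    "c + s \<notin> unpaired_R ?u ?v"
    unfolding RF_unpaired[OF assms(1-3)] RF_unpaired[OF RF' assms(2,3)] sets by (fact step)+
  show "phi i ws = Suc (phi i ws')"
    unfolding phi_def recs(1) using recs(2) finite_unpaired[OF RF' assms(2,3)] by simp
  show "eps i ws' = Suc (eps i ws)"
    unfolding eps_def exs(1) using exs(2) finite_unpaired[OF assms(1-3)] by simp
  show "rf_wt ws' = rf_wt ws - simple_root i"
    unfolding ws' u'_def[symmetric] v'_def[symmetric]
    using assms(2,3) len lens by (intro rf_wt_step) auto
  have "Max (unpaired_L ?u ?v) = c" "unpaired_L ?u ?v \<noteq> {}"
    using step(5) recs(1) RF_unpaired[OF assms(1-3)] by auto
  then show "f_even i ws = Some ws'"
    using step(6) by (simp add: f_even_def Let_def ws')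
  have "Min (unpaired_R (ws' ! (i - 1)) (ws' ! i)) = c + s"
    unfolding RF_unpaired[OF RF' assms(2,3)] sets by (rule step(7))
  moreover have "unpaired_R (ws' ! (i - 1)) (ws' ! i) \<noteq> {}"
    using exs(1) by simp
  moreover have "set ?u - {c} \<union> {c} = set ?u" "insert (c + s) (set ?v) - {c + s} = set ?v"
    using c by auto
  moreover have "ws'[i - 1 := ?u, i := ?v] = ws"
    using assms(2,3) len by (intro nth_equalityI) (auto simp: ws' nth_list_update)
  ultimately show "e_even i ws' = Some ws"
    by (simp only: e_even_def Let_def sets step(8) iw if_False add_diff_cancel_right')
qed

text \<open>The path gives every condition on the run except that \<open>c + s\<close> is missing
  from the second block. If it were there, both blocks would contain the full run and two letters
  would cancel, against minimality.\<close>

lemma f_even_imp_step: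
  assumes "ws \<in> RF_fpf m z" "1 \<le> i" "i < m" "f_even i ws = Some ws'"
  shows "even_step i ws ws'"
proof -
  let ?U = "set (ws ! (i - 1))" and ?V = "set (ws ! i)"
  define c where "c = Max (records (height ?U ?V))"
  define s where "s = (LEAST j. c + j + 1 \<notin> ?U)"
  note unp = RF_unpaired[OF assms(1-3)]
  have i: "Suc (i - 1) = i" using assms(2) by simp
  have ne: "records (height ?U ?V) \<noteq> {}"
    using assms(4) unp by (auto simp: f_even_def Let_def split: if_splits)
  have k: "i - 1 < m" using assms(3) by simp
  note u = RF_blocks[OF assms(1) k] and v = RF_blocks[OF assms(1) assms(3)]
  note run = run_of_record[OF List.finite_set List.finite_set v(2) ne c_def s_def]
  have "c + s \<notin> ?V"
  proof
    assume cs: "c + s \<in> ?V"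
    have "word_perm (incr_word ?U @ incr_word ?V) =
        word_perm (incr_word (?U - {c}) @ incr_word (?V - {c + s}))"
    proof (rule word_perm_block_cancel)
      show "{c..c + s} \<subseteq> ?V"
      proof
        fix x assume "x \<in> {c..c + s}"
        then show "x \<in> ?V" using run(2) cs by (cases "x = c + s") auto
      qed
    qed (fact run List.finite_set)+
    then have eq: "word_perm (incr_word (?U - {c}) @ incr_word (?V - {c + s})) =
        word_perm (ws ! (i - 1) @ ws ! Suc (i - 1))"
      unfolding u(3) v(3) i by (rule sym)
    have "length (ws ! (i - 1)) + length (ws ! i) \<le>
        length (incr_word (?U - {c})) + length (incr_word (?V - {c + s}))"
      using RF_exchange(1)[OF assms(1) _ _ _ eq] assms(3) u(2) v(2) unfolding i by simp
    moreover have "c \<in> ?U" using run(1) by auto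
    ultimately show False
      using cs u(4) v(4) card_Suc_Diff1[of ?U c] card_Suc_Diff1[of ?V "c + s"] by simp
  qed
  then have "lowest_run ?U ?V c s" using run(6) by simp
  moreover have "ws' = ws[i - 1 := incr_word (?U - {c}), i := incr_word (insert (c + s) ?V)]"
    using assms(4) ne unp by (simp add: f_even_def Let_def c_def s_def)
  ultimately show ?thesis by (auto simp: even_step_def)
qed

text \<open>The same argument from the other side. The exchange is then read backwards, which also
  shows that the reconstructed \<open>ws\<close> is a factorization of a minimal word.\<close>

lemma e_even_imp_step:
  assumes "ws' \<in> RF_fpf m z" "1 \<le> i" "i < m" "e_even i ws' = Some ws"
  shows "ws \<in> RF_fpf m z" "even_step i ws ws'"
proof -
  let ?u = "ws' ! (i - 1)" and ?v = "ws' ! i"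
  let ?U = "set ?u" and ?V = "set ?v"
  define c where "c = Min (exits (height ?U ?V))"
  define t where "t = (LEAST j. c - j - 1 \<notin> ?V)"
  note unp = RF_unpaired[OF assms(1-3)]
  have i: "Suc (i - 1) = i" using assms(2) by simp
  have len: "length ws' = m" using assms(1) by (simp add: RF_fpf_def)
  have ne: "exits (height ?U ?V) \<noteq> {}"
    using assms(4) unp by (auto simp: e_even_def Let_def split: if_splits)
  have k: "i - 1 < m" using assms(3) by simp
  note u = RF_blocks[OF assms(1) k] and v = RF_blocks[OF assms(1) assms(3)]
  note run = run_of_exit[OF List.finite_set List.finite_set v(2) ne c_def t_def]
  have t: "t < c" and cV: "c \<in> ?V" using run(1,3) by auto
  have "c - t \<notin> ?U"
  proof
    assume ct: "c - t \<in> ?U"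
    have "word_perm (incr_word ?U @ incr_word ?V) =
        word_perm (incr_word (?U - {c - t}) @ incr_word (?V - {c - t + t}))"
    proof (rule word_perm_block_cancel)
      show "{c - t..c - t + t} \<subseteq> ?U"
      proof
        fix x assume "x \<in> {c - t..c - t + t}"
        then show "x \<in> ?U" using run(2) ct t by (cases "x = c - t") auto
      qed
    qed (use run t in simp_all)
    then have eq: "word_perm (incr_word (?U - {c - t}) @ incr_word (?V - {c})) =
        word_perm (ws' ! (i - 1) @ ws' ! Suc (i - 1))"
      unfolding u(3) v(3) i using t by simp
    have "length (ws' ! (i - 1)) + length (ws' ! i) \<le>
        length (incr_word (?U - {c - t})) + length (incr_word (?V - {c}))"
      using RF_exchange(1)[OF assms(1) _ _ _ eq] assms(3) u(2) v(2) unfolding i by simp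
    then show False
      using ct cV u(4) v(4) card_Suc_Diff1[of ?U "c - t"] card_Suc_Diff1[of ?V c] by simp
  qed
  then have lr: "lowest_run (insert (c - t) ?U) (?V - {c}) (c - t) t" using run(6) by simp
  have ws: "ws = ws'[i - 1 := incr_word (insert (c - t) ?U), i := incr_word (?V - {c})]"
    using assms(4) ne unp by (simp add: e_even_def Let_def c_def t_def)
  have undo: "insert (c - t) ?U - {c - t} = ?U" "insert (c - t + t) (?V - {c}) = ?V"
    using \<open>c - t \<notin> ?U\<close> cV t by auto
  define a b where "a = incr_word (insert (c - t) ?U)" and "b = incr_word (?V - {c})"
  have a: "set a = insert (c - t) ?U" "sorted_wrt (<) a" and b: "set b = ?V - {c}" "sorted_wrt (<) b"
    unfolding a_def b_def by (simp_all only: set_sorted_list_of_set finite_Diff finite_insert List.finite_set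
        strict_sorted_list_of_set)
  have lens: "length a = Suc (length ?u)" "length ?v = Suc (length b)"
    using u(4) v(4) \<open>c - t \<notin> ?U\<close> card_Suc_Diff1[OF _ cV] by (simp_all add: a_def b_def)
  have "ws'[i - 1 := a, Suc (i - 1) := b] \<in> RF_fpf m z"
  proof (rule RF_exchange(2)[OF assms(1)])
    show "word_perm (a @ b) = word_perm (ws' ! (i - 1) @ ws' ! Suc (i - 1))"
      unfolding i a_def b_def using lowest_run_step(9)[OF lr] unfolding undo u(3) v(3) .
    show "length (ws' ! (i - 1)) + length (ws' ! Suc (i - 1)) = length a + length b"
      unfolding i using lens by linarith
  qed (use assms(2,3) u(2) v(2) t a b in auto)
  then show "ws \<in> RF_fpf m z" unfolding ws a_def b_def i .
  have nth: "set (ws ! (i - 1)) = insert (c - t) ?U" "set (ws ! i) = ?V - {c}"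
    unfolding a(1)[symmetric] b(1)[symmetric] ws a_def[symmetric] b_def[symmetric]
    using assms(2,3) len by simp_all
  have "ws[i - 1 := ?u, i := ?v] = ws'"
    using assms(2,3) len by (intro nth_equalityI) (auto simp: ws nth_list_update)
  then show "even_step i ws ws'"
    unfolding even_step_def nth
    by (intro exI[of _ "c - t"] exI[of _ t] conjI lr) (simp only: undo u(3) v(3))
qed

section \<open>String lengths\<close>

lemma f_even_None:
  assumes "ws \<in> RF_fpf m z" "1 \<le> i" "i < m"
  shows "f_even i ws = None \<longleftrightarrow> phi i ws = 0"
  using finite_unpaired[OF assms] by (simp add: f_even_def phi_def Let_def)

lemma e_even_None:
  assumes "ws \<in> RF_fpf m z" "1 \<le> i" "i < m"
  shows "e_even i ws = None \<longleftrightarrow> eps i ws = 0"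
  using finite_unpaired[OF assms] by (simp add: e_even_def eps_def Let_def)

text \<open>A rank that falls by one along \<open>g\<close> and vanishes exactly where
  \<open>g\<close> is undefined counts the applications that are still possible.\<close>

lemma string_set_rank:
  assumes "\<And>b b'. b \<in> B \<Longrightarrow> g b = Some b' \<Longrightarrow> b' \<in> B \<and> r b = Suc (r b')"
    and "\<And>b. b \<in> B \<Longrightarrow> g b = None \<longleftrightarrow> r b = 0" and "b \<in> B"
  shows "string_set B g b = {..r b}"
  using assms(3)
proof (induction "r b" arbitrary: b rule: less_induct)
  case less
  have None: "op_power g k b = None" if "g b = None" "0 < k" for k
  proof -
    have "((\<lambda>x. Option.bind x g) ^^ j) None = None" for j by (induction j) auto
    then show ?thesis using that by (cases k) (simp_all add: op_power_def funpow_Suc_right del: funpow.simps)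
  qed
  \<comment> \<open>Powers are unrolled at the first application, since the induction passes from
    \<open>b\<close> to \<open>b'\<close>.\<close>
  have Some: "op_power g (Suc k) b = op_power g k b'" if "g b = Some b'" for k b'
    using that by (simp add: op_power_def funpow_Suc_right del: funpow.simps)
  have zero: "0 \<in> string_set B g b" using less.prems by (simp add: string_set_def op_power_def)
  show ?case
  proof (cases "g b")
    case (Some b')
    then have b': "b' \<in> B" "r b = Suc (r b')" using assms(1) less.prems by auto
    then have IH: "string_set B g b' = {..r b'}" using less.hyps by simp
    have "k \<in> string_set B g b \<longleftrightarrow> k \<le> r b" for k
    proof (cases k)
      case (Suc j)
      then have "k \<in> string_set B g b \<longleftrightarrow> j \<in> string_set B g b'"
        by (simp add: string_set_def \<open>\<And>k b'. g b = Some b' \<Longrightarrow> op_power g (Suc k) b = op_power g k b'\<close>[OF Some])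
      then show ?thesis using IH b' Suc by simp
    qed (simp add: zero)
    then show ?thesis by auto
  next
    case None
    then have "r b = 0" using assms(2) less.prems by simp
    moreover have "k \<notin> string_set B g b" if "0 < k" for k
      using \<open>\<And>k. g b = None \<Longrightarrow> 0 < k \<Longrightarrow> op_power g k b = None\<close>[OF None that] by (auto simp: string_set_def)
    ultimately show ?thesis using zero by (auto intro: ccontr)
  qed
qed

lemma string_set_f_even:
  assumes "ws \<in> RF_fpf m z" "1 \<le> i" "i < m"
  shows "string_set (RF_fpf m z) (f_even i) ws = {..phi i ws}"
proof (rule string_set_rank[OF _ _ assms(1)])
  fix b b' assume b: "b \<in> RF_fpf m z"
  then show "f_even i b = None \<longleftrightarrow> phi i b = 0" using assms(2,3) by (rule f_even_None)
  assume step: "f_even i b = Some b'"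
  show "b' \<in> RF_fpf m z \<and> phi i b = Suc (phi i b')"
    using even_step_RF[OF b assms(2,3) f_even_imp_step[OF b assms(2,3) step]] by simp
qed

lemma string_set_e_even:
  assumes "ws \<in> RF_fpf m z" "1 \<le> i" "i < m"
  shows "string_set (RF_fpf m z) (e_even i) ws = {..eps i ws}"
proof (rule string_set_rank[OF _ _ assms(1)])
  fix b b' assume b: "b \<in> RF_fpf m z"
  then show "e_even i b = None \<longleftrightarrow> eps i b = 0" using assms(2,3) by (rule e_even_None)
  assume step: "e_even i b = Some b'"
  show "b' \<in> RF_fpf m z \<and> eps i b = Suc (eps i b')"
    using e_even_imp_step[OF b assms(2,3) step] even_step_RF[OF _ assms(2,3)] by blast
qed

lemma phi_minus_eps:
  assumes "ws \<in> RF_fpf m z" "1 \<le> i" "i < m"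
  shows "int (phi i ws) = int (eps i ws) + coroot_pairing (rf_wt ws) i"
proof -
  have "length ws = m" using assms(1) by (simp add: RF_fpf_def)
  moreover have "distinct (ws ! (i - 1))" "distinct (ws ! i)"
    using RF_blocks(1)[OF assms(1), of "i - 1"] RF_blocks(1)[OF assms(1), of i] assms(2,3)
    by (auto simp: strict_sorted_iff)
  ultimately show ?thesis
    using card_unpaired[of "ws ! (i - 1)" "ws ! i"] assms(2,3)
    by (simp add: phi_def eps_def coroot_pairing_def lookup_rf_wt)
qed

section \<open>The gl(m)-crystal axioms\<close>

lemma gl_crystal_RF: "gl_crystal m (RF_fpf m z) rf_wt e_even f_even"
proof
  fix ws ws' and i :: nat
  assume i: "1 \<le> i" "i < m" and ws: "ws \<in> RF_fpf m z"
  have [simp]: "Max {..n} = n" for n :: nat by (rule Max_eqI) auto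
  note lengths = string_length_def string_set_f_even string_set_e_even
  show "finite (string_set (RF_fpf m z) (e_even i) ws)" "finite (string_set (RF_fpf m z) (f_even i) ws)"
    using i ws by (simp_all add: lengths)
  show "string_length (RF_fpf m z) (f_even i) ws =
      string_length (RF_fpf m z) (e_even i) ws + coroot_pairing (rf_wt ws) i"
    using i ws phi_minus_eps by (simp add: lengths)
  {
    assume e: "e_even i ws = Some ws'"
    note ws' = e_even_imp_step[OF ws i e]
    note step = even_step_RF[OF ws'(1) i ws'(2)]
    show "ws' \<in> RF_fpf m z" by (fact ws'(1))
    show "rf_wt ws' = rf_wt ws + simple_root i" using step(6) by simp
    show "string_length (RF_fpf m z) (e_even i) ws' = string_length (RF_fpf m z) (e_even i) ws - 1"
      "string_length (RF_fpf m z) (f_even i) ws' = string_length (RF_fpf m z) (f_even i) ws + 1"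
      using i ws ws'(1) step(4,5) by (simp_all add: lengths)
  next
    assume f: "f_even i ws = Some ws'"
    note step = even_step_RF[OF ws i f_even_imp_step[OF ws i f]]
    show "ws' \<in> RF_fpf m z" "rf_wt ws' = rf_wt ws - simple_root i" by (fact step)+
    show "string_length (RF_fpf m z) (e_even i) ws' = string_length (RF_fpf m z) (e_even i) ws + 1"
      "string_length (RF_fpf m z) (f_even i) ws' = string_length (RF_fpf m z) (f_even i) ws - 1"
      using i ws step(1,4,5) by (simp_all add: lengths)
  next
    assume "ws' \<in> RF_fpf m z"
    then show "f_even i ws = Some ws' \<longleftrightarrow> e_even i ws' = Some ws"
      using even_step_RF(2,3)[OF ws i, of ws'] f_even_imp_step[OF ws i, of ws']
        e_even_imp_step(2)[OF _ i, of ws' z ws] by blast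
  }
next
  fix ws assume "ws \<in> RF_fpf m z"
  then show "Poly_Mapping.keys (rf_wt ws) \<subseteq> {1..m}"
    by (auto simp: in_keys_iff lookup_rf_wt RF_fpf_def split: if_splits)
qed

section \<open>Odd operators\<close>

text \<open>The graph of the odd lowering operator on the first two blocks. \<open>move\<close>
  covers a single letter and a first gap alike; in \<open>shift\<close> the subtraction is safe
  because \<open>a\<close> is even and positive at the start of a minimal word.\<close>

inductive odd_step :: "nat list \<Rightarrow> nat list \<Rightarrow> nat list \<Rightarrow> nat list \<Rightarrow> bool" where
  move: "\<lbrakk>\<forall>y\<in>set u. a + 1 < y; \<forall>y\<in>set v. a < y\<rbrakk> \<Longrightarrow> odd_step (a # u) v u (a # v)"
| shift: "\<forall>y\<in>set v. a < y \<Longrightarrow> odd_step (a # (a + 1) # u) v (a # u) ((a - 1) # v)"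

lemma RF_ConsD:
  assumes "u # v # r \<in> RF_fpf m z"
  shows "sorted_wrt (<) u" "sorted_wrt (<) v" "u @ v @ concat r \<in> fpf_involution_words z"
    "0 \<notin> set u" "0 \<notin> set v"
  using assms fpf_words_pos[of "u @ v @ concat r" z] by (auto simp: RF_fpf_def)

lemma RF_head_even: "(a # u) # r \<in> RF_fpf m z \<Longrightarrow> even a \<and> 0 < a"
  using fpf_words_head_even[of a "u @ concat r" z] fpf_words_pos[of "a # u @ concat r" z]
  by (auto simp: RF_fpf_def)

text \<open>Relations that involve \<open>Theta\<close> hold only at the beginning of a word, so the
  first two blocks are compared by \<open>twist\<close> and not by their permutation.\<close>

lemma RF_front_minimal:
  assumes "u # v # r \<in> RF_fpf m z" "twist w = twist (u @ v)" "0 \<notin> set w"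
  shows "length u + length v \<le> length w"
proof -
  have "twist (w @ concat r) = twist (u @ v @ concat r)"
    using twist_append_cong[OF assms(2), of "concat r"] by simp
  moreover have "0 \<notin> set (w @ concat r)"
    using fpf_words_pos[OF RF_ConsD(3)[OF assms(1)]] assms(3) by auto
  ultimately show ?thesis
    using fpf_words_minimal[OF RF_ConsD(3)[OF assms(1)]] by fastforce
qed

lemma RF_front_cong:
  assumes "u # v # r \<in> RF_fpf m z" "twist w = twist (u @ v)" "0 \<notin> set w" "length w = length u + length v"
  shows "w @ concat r \<in> fpf_involution_words z"
proof (rule fpf_words_cong[OF RF_ConsD(3)[OF assms(1)]])
  show "twist (w @ concat r) = twist (u @ v @ concat r)"
    using twist_append_cong[OF assms(2), of "concat r"] by simp
  show "0 \<notin> set (w @ concat r)"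
    using fpf_words_pos[OF RF_ConsD(3)[OF assms(1)]] assms(3) by auto
qed (simp add: assms(4))

text \<open>At the front \<open>a + 1\<close> becomes \<open>a - 1\<close>, which commutes with all
  of \<open>u\<close> and so slides into the second block.\<close>

lemma twist_shift:
  assumes "even a" "0 < a" "\<forall>y\<in>set u. a + 1 < y"
  shows "twist ((a # (a + 1) # u) @ v) = twist ((a # u) @ (a - 1) # v)"
proof -
  have "twist ((a # (a + 1) # u) @ v) = twist ([a, a - 1] @ u @ v)"
    using twist_append_cong[OF twist_even_letter[OF assms(1,2)], of "u @ v"] by simp
  also have "\<dots> = twist ([a] @ ((a - 1) # u) @ v)"
    by simp
  also have "\<dots> = twist ([a] @ (u @ [a - 1]) @ v)"
    using assms(3)
    by (intro twist_cong word_perm_append_cong refl word_perm_commute_letter[symmetric]) force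
  finally show ?thesis by simp
qed

text \<open>A shift keeps the first letter \<open>a\<close>, so membership of either factorization
  shows that \<open>a\<close> is even; the disjunction lets the lemma serve both directions.\<close>

lemma odd_step_twist:
  assumes "odd_step u v u' v'" "u # v # r \<in> RF_fpf m z \<or> u' # v' # r \<in> RF_fpf m z" "sorted_wrt (<) u"
  shows "twist (u @ v) = twist (u' @ v')"
  using assms(1)
proof (cases rule: odd_step.cases)
  case (move a)
  have "word_perm (u' @ [a]) = word_perm (a # u')"
    using move by (intro word_perm_commute_letter) auto
  then have "twist ((a # u') @ v) = twist ((u' @ [a]) @ v)"
    by (intro twist_cong word_perm_append_cong refl) simp
  then show ?thesis using move by simp
next
  case (shift a x)
  then have "even a \<and> 0 < a" using assms(2) RF_head_even by auto
  then show ?thesis using assms(3) shift twist_shift[of a x v] by auto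
qed

lemma odd_step_length: "odd_step u v u' v' \<Longrightarrow> length u' + length v' = length u + length v"
  by (auto elim: odd_step.cases)

lemma odd_step_RF:
  assumes "odd_step u v u' v'" "u # v # r \<in> RF_fpf m z"
  shows "u' # v' # r \<in> RF_fpf m z"
proof -
  note uv = RF_ConsD[OF assms(2)]
  have "sorted_wrt (<) u' \<and> sorted_wrt (<) v' \<and> 0 \<notin> set (u' @ v')"
    using assms(1)
  proof (cases rule: odd_step.cases)
    case (move a)
    then show ?thesis using uv by auto
  next
    case (shift a x)
    then have "even a \<and> 0 < a" using assms(2) RF_head_even by auto
    \<comment> \<open>Evenness excludes \<open>a = 1\<close>, so the new letter \<open>a - 1\<close>
      is positive.\<close>
    then have "1 < a" by (auto elim!: evenE)
    then show ?thesis using uv shift by auto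
  qed
  moreover from this have "(u' @ v') @ concat r \<in> fpf_involution_words z"
    using odd_step_twist[OF assms(1) disjI1[OF assms(2)] uv(1)] odd_step_length[OF assms(1)]
    by (intro RF_front_cong[OF assms(2)]) auto
  ultimately show ?thesis using assms(2) by (auto simp: RF_fpf_def)
qed

lemma odd_step_RF_converse:
  assumes "odd_step u v u' v'" "u' # v' # r \<in> RF_fpf m z" "sorted_wrt (<) u" "sorted_wrt (<) v"
  shows "u # v # r \<in> RF_fpf m z"
proof -
  have "0 \<notin> set (u @ v)"
    using assms(1) RF_ConsD(4,5)[OF assms(2)] by (cases rule: odd_step.cases) auto
  then have "(u @ v) @ concat r \<in> fpf_involution_words z"
    using odd_step_twist[OF assms(1) disjI2[OF assms(2)] assms(3)] odd_step_length[OF assms(1)]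
    by (intro RF_front_cong[OF assms(2)]) auto
  then show ?thesis using assms by (auto simp: RF_fpf_def)
qed

section \<open>The odd operators as the two directions of \<open>odd_step\<close>\<close>

lemma f_odd_op_iff:
  assumes "sorted_wrt (<) u" "sorted_wrt (<) v"
  shows "f_odd_op (u # v # r) = Some ws' \<longleftrightarrow> (\<exists>u' v'. ws' = u' # v' # r \<and> odd_step u v u' v')"
proof -
  \<comment> \<open>For empty \<open>v\<close> the quantifier is vacuous, which is the dropped
    condition.\<close>
  have small: "(v = [] \<or> a < Min (set v)) \<longleftrightarrow> (\<forall>y\<in>set v. a < y)" for a
    by (cases "v = []") auto
  have ins: "incr_word (set v \<union> {a}) = a # v" if "\<forall>y\<in>set v. a < y" for a
    using that assms(2) by (intro incr_word_eqI) auto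
  consider "u = []" | a where "u = [a]" | a b x where "u = a # b # x" "a + 1 < b" | a x where "u = a # (a + 1) # x"
  \<comment> \<open>The rule only serves to split off the first two letters.\<close>
  proof (cases u rule: remdups_adj.cases)
    case (3 a b x)
    then have "b = a + 1 \<or> a + 1 < b" using assms(1) by auto
    with 3 that show ?thesis by blast
  qed (use that in auto)
  then show ?thesis
  proof cases
    case 1
    then show ?thesis by (auto simp: f_odd_op_def odd_step.simps)
  next
    case (2 a)
    then show ?thesis
      by (auto simp: f_odd_op_def Let_def small ins odd_step.simps simp del: Un_insert_right)
  next
    case (3 a b x)
    have "incr_word (set u - {a}) = b # x"
      using 3 assms(1) by (intro incr_word_eqI) auto
    moreover have "\<forall>y\<in>set (b # x). a + 1 < y" using 3 assms(1) by auto
    ultimately show ?thesis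
      using 3 by (auto simp: f_odd_op_def Let_def small ins odd_step.simps simp del: Un_insert_right)
  next
    case (4 a x)
    have "incr_word (set u - {a + 1}) = a # x"
      using 4 assms(1) by (intro incr_word_eqI) auto
    moreover have "incr_word (set v \<union> {a - 1}) = (a - 1) # v" if "\<forall>y\<in>set v. a < y"
      using that by (intro ins) force
    ultimately show ?thesis
      using 4 by (auto simp: f_odd_op_def Let_def small odd_step.simps simp del: Un_insert_right)
  qed
qed

text \<open>The first letters reveal the kind of step: after a move the first block is empty or
  starts more than one above the second, after a shift exactly one above. Positivity of
  \<open>hd u\<close> makes \<open>a - 1 + 1\<close> equal to \<open>a\<close>.\<close>

lemma e_odd_op_complete:
  assumes "odd_step u v u' v'" "sorted_wrt (<) u" "sorted_wrt (<) v" "0 < hd u"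
  shows "e_odd_op (u' # v' # r) = Some (u # v # r)"
  using assms(1)
proof (cases rule: odd_step.cases)
  case (move a)
  have "incr_word (set v' - {a}) = v"
    using move assms(3) by (intro incr_word_eqI) auto
  moreover have "incr_word (set u' \<union> {a}) = u"
    using move assms(2) by (intro incr_word_eqI) auto
  ultimately show ?thesis
    using move by (cases u') (auto simp: e_odd_op_def Let_def simp del: Un_insert_right)
next
  case (shift a x)
  have "incr_word (set v' - {a - 1}) = v"
    using shift assms(3) by (intro incr_word_eqI) auto
  moreover have "incr_word (set u' \<union> {a + 1}) = u"
    using shift assms(2) by (intro incr_word_eqI) auto
  ultimately show ?thesis
    using shift assms(4) by (auto simp: e_odd_op_def Let_def simp del: Un_insert_right)
qed

text \<open>
  If \<open>u' = a # x\<close> and \<open>v' = (a - 1) # y\<close>, then \<open>a + 1 \<in> set x\<close> would allow the cancellation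
  \<open>a (a+1) (a-1) \<rightarrow> a (a-1) (a-1)\<close>, and \<open>a \<in> set y\<close> would allow the braid move
  \<open>a (a-1) a \<rightarrow> (a-1) a (a-1)\<close> to an odd first letter.
\<close>

lemma RF_shift_gaps:
  assumes RF: "(a # x) # ((a - 1) # y) # r \<in> RF_fpf m z"
  shows "\<forall>b\<in>set x. a + 1 < b" "\<forall>b\<in>set y. a < b"
proof -
  note D = RF_ConsD[OF RF]
  have a: "even a" "0 < a" using RF_head_even[OF RF] by auto
  have pos: "0 \<notin> set x" "0 \<notin> set y" "0 < a - 1" using D by auto
  have "a + 1 \<notin> set x"
  proof
    assume "a + 1 \<in> set x"
    then obtain x' where x: "x = (a + 1) # x'" and x': "\<forall>b\<in>set x'. a + 1 < b"
      using D(1) by (cases x) auto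
    have "twist ((a # x) @ (a - 1) # y) = twist ([a, a + 1] @ x' @ [a - 1] @ y)"
      by (simp add: x)
    also have "\<dots> = twist ([a, a - 1] @ x' @ [a - 1] @ y)"
      by (rule twist_append_cong) (rule twist_even_letter[OF a])
    also have "\<dots> = twist ([a, a - 1] @ (x' @ [a - 1]) @ y)"
      by simp
    also have "\<dots> = twist ([a, a - 1] @ ((a - 1) # x') @ y)"
      using x' by (intro twist_cong word_perm_append_cong refl word_perm_commute_letter) force
    also have "\<dots> = twist ([a] @ ([a - 1, a - 1] @ (x' @ y)))"
      by simp
    also have "\<dots> = twist ([a] @ ([] @ (x' @ y)))"
      by (intro twist_cong word_perm_append_cong refl) (simp add: word_perm_Cons)
    finally have "length (a # x) + length ((a - 1) # y) \<le> length ([a] @ ([] @ (x' @ y)))"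
      using pos a x by (intro RF_front_minimal[OF RF]) auto
    then show False by (simp add: x)
  qed
  show gap: "\<forall>b\<in>set x. a + 1 < b"
  proof
    fix b assume "b \<in> set x"
    then have "a < b" "b \<noteq> a + 1" using D(1) \<open>a + 1 \<notin> set x\<close> by auto
    then show "a + 1 < b" by simp
  qed
  have "a \<notin> set y"
  proof
    assume "a \<in> set y"
    then obtain c y' where cy: "y = c # y'" by (cases y) auto
    then have "a - 1 < c" "c = a \<or> c < a" using D(2) \<open>a \<in> set y\<close> by auto
    then have y: "y = a # y'" using cy by auto
    have comm: "word_perm ([a - 1, a] @ x) = word_perm (x @ [a - 1, a])"
      using gap by (intro word_perm_commute) force
    have braid: "word_perm [a - 1, a, a - 1] = word_perm [a, a - 1, a]"
      using simple_transp_braid[of "a - 1"] a(2) by (simp add: word_perm_Cons)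
    \<comment> \<open>Best read from the end: \<open>a - 1\<close> and \<open>a\<close> commute with
      \<open>x\<close> by the gap just shown, which brings them next to the leading \<open>a\<close>
      for the braid move.\<close>
    have "twist ((a - 1) # (a # (a - 1) # x @ y')) = twist ([a - 1, a, a - 1] @ (x @ y'))"
      by simp
    also have "\<dots> = twist ([a, a - 1, a] @ (x @ y'))"
      by (intro twist_cong word_perm_append_cong refl braid)
    also have "\<dots> = twist ([a] @ ([a - 1, a] @ x) @ y')"
      by simp
    also have "\<dots> = twist ([a] @ (x @ [a - 1, a]) @ y')"
      by (rule twist_cong, rule word_perm_append_cong[OF refl word_perm_append_cong[OF comm refl]])
    also have "\<dots> = twist ((a # x) @ (a - 1) # y)"
      by (simp add: y)
    finally have "((a - 1) # (a # (a - 1) # x @ y')) @ concat r \<in> fpf_involution_words z"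
      using pos a y by (intro RF_front_cong[OF RF]) auto
    then have "even (a - 1)" unfolding append_Cons by (rule fpf_words_head_even)
    then show False using a by simp
  qed
  show "\<forall>b\<in>set y. a < b"
  proof
    fix b assume "b \<in> set y"
    then have "a - 1 < b" "b \<noteq> a" using D(2) \<open>a \<notin> set y\<close> by auto
    then show "a < b" by simp
  qed
qed

text \<open>When the first letters differ by one, the shape of the step depends on minimality:
  \<open>RF_shift_gaps\<close> ensures that \<open>d + 1\<close> is new in the first block and that
  \<open>d\<close> lies below the rest of the second.\<close>

lemma e_odd_op_sound:
  assumes RF: "u' # v' # r \<in> RF_fpf m z" and e: "e_odd_op (u' # v' # r) = Some ws"
  shows "\<exists>u v. ws = u # v # r \<and> u # v # r \<in> RF_fpf m z \<and> odd_step u v u' v'"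
proof -
  note D = RF_ConsD[OF RF]
  obtain b y where v': "v' = b # y" using e by (cases v') (auto simp: e_odd_op_def)
  have y: "incr_word (set v' - {b}) = y" "sorted_wrt (<) y" "\<forall>c\<in>set y. b < c"
    using v' D(2) by (auto intro!: incr_word_eqI)
  consider "u' = []" | d x where "u' = d # x" "d > b + 1" | d x where "u' = d # x" "d = b + 1"
    using e v' by (cases u') (force simp: e_odd_op_def split: if_splits)+
  then have "\<exists>u v. ws = u # v # r \<and> sorted_wrt (<) u \<and> sorted_wrt (<) v \<and> odd_step u v u' v'"
  proof cases
    case 1
    then have "ws = [b] # y # r" using e v' y(1) by (simp add: e_odd_op_def Let_def)
    then show ?thesis using 1 v' y by (auto intro!: odd_step.move)
  next
    case (2 d x)
    have "incr_word (set u' \<union> {b}) = b # u'" using 2 D(1) by (intro incr_word_eqI) auto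
    then have "ws = (b # u') # y # r"
      using 2 e v' y(1) by (simp add: e_odd_op_def Let_def del: Un_insert_right)
    moreover have "odd_step (b # u') y u' (b # y)" using 2 D(1) y by (intro odd_step.move) auto
    moreover have "sorted_wrt (<) (b # u')" using 2 D(1) by auto
    ultimately show ?thesis using v' y(2) by blast
  next
    case (3 d x)
    then have b: "b = d - 1" by simp
    have gaps: "\<forall>c\<in>set x. d + 1 < c" "\<forall>c\<in>set y. d < c"
      using RF_shift_gaps[of d x y r m z] RF unfolding 3(1) v' b by auto
    have "incr_word (set u' \<union> {d + 1}) = d # (d + 1) # x"
      using 3 D(1) gaps by (intro incr_word_eqI) auto
    then have "ws = (d # (d + 1) # x) # y # r"
      using 3 e v' y(1) by (simp add: e_odd_op_def Let_def del: Un_insert_right)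
    moreover have "odd_step (d # (d + 1) # x) y u' v'"
      unfolding 3(1) v' b by (intro odd_step.shift gaps)
    moreover have "sorted_wrt (<) (d # (d + 1) # x)" using 3 D(1) gaps by auto
    ultimately show ?thesis using y(2) by blast
  qed
  then show ?thesis using odd_step_RF_converse[OF _ RF] by blast
qed

section \<open>Locality and commutation\<close>

lemma odd_op_local:
  "\<exists>g. \<forall>r. f_odd_op (u # v # r) = map_option (\<lambda>(u', v'). u' # v' # r) g"
  "\<exists>g. \<forall>r. e_odd_op (u # v # r) = map_option (\<lambda>(u', v'). u' # v' # r) g"
proof -
  have "f_odd_op (u # v # r) = map_option (\<lambda>(u', v'). u' # v' # r) (map_option (\<lambda>ws. (ws ! 0, ws ! 1)) (f_odd_op [u, v]))" for r
    by (auto simp: f_odd_op_def Let_def simp del: Min_gr_iff)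
  then show "\<exists>g. \<forall>r. f_odd_op (u # v # r) = map_option (\<lambda>(u', v'). u' # v' # r) g" by blast
  have "e_odd_op (u # v # r) = map_option (\<lambda>(u', v'). u' # v' # r) (map_option (\<lambda>ws. (ws ! 0, ws ! 1)) (e_odd_op [u, v]))" for r
    by (simp add: e_odd_op_def Let_def)
  then show "\<exists>g. \<forall>r. e_odd_op (u # v # r) = map_option (\<lambda>(u', v'). u' # v' # r) g" by blast
qed

lemma even_op_local:
  assumes "3 \<le> i"
  shows "f_even i (u # v # r) = map_option (\<lambda>r'. u # v # r') (f_even (i - 2) r)"
    and "e_even i (u # v # r) = map_option (\<lambda>r'. u # v # r') (e_even (i - 2) r)"
proof -
  \<comment> \<open>With three successors visible, indexing skips the first two blocks by
    computation; \<open>i - 2\<close> is still at least 1.\<close>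
  have "i = Suc (Suc (Suc (i - 3)))" using assms by simp
  then obtain k where "i = Suc (Suc (Suc k))" ..
  then show "f_even i (u # v # r) = map_option (\<lambda>r'. u # v # r') (f_even (i - 2) r)"
    and "e_even i (u # v # r) = map_option (\<lambda>r'. u # v # r') (e_even (i - 2) r)"
    by (simp_all add: f_even_def e_even_def Let_def)
qed

text \<open>\<open>h\<close> sees only the first two blocks and \<open>k\<close> only the others, so
  they commute, also where one of them is undefined.\<close>

lemma local_ops_commute:
  assumes "\<exists>g. \<forall>r. h (u # v # r) = map_option (\<lambda>(u', v'). u' # v' # r) g"
    and k: "\<And>u v. k (u # v # r) = map_option (\<lambda>r'. u # v # r') k'"
  shows "Option.bind (k (u # v # r)) h = Option.bind (h (u # v # r)) k"
proof -
  obtain g where "\<And>r. h (u # v # r) = map_option (\<lambda>(u', v'). u' # v' # r) g" using assms(1) by blast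
  then show ?thesis by (cases g; cases k') (auto simp: k)
qed

lemma rf_wt_odd_step:
  assumes "odd_step u v u' v'"
  shows "rf_wt (u' # v' # r) = rf_wt (u # v # r) - simple_root 1"
proof -
  have "length u = Suc (length u')" "length v' = Suc (length v)"
    using assms by (auto elim: odd_step.cases)
  then show ?thesis using rf_wt_step[of 1 "u # v # r" u' v'] by simp
qed

lemma RF_ConsE:
  assumes "ws \<in> RF_fpf m z" "2 \<le> m"
  obtains u v r where "ws = u # v # r"
proof -
  have "2 \<le> length ws" using assms by (simp add: RF_fpf_def)
  then show ?thesis using that by (cases ws; cases "tl ws") auto
qed

lemma f_odd_op_step:
  assumes "ws \<in> RF_fpf m z" "2 \<le> m" "f_odd_op ws = Some ws'"
  obtains u v u' v' r where "ws = u # v # r" "ws' = u' # v' # r" "odd_step u v u' v'" "ws' \<in> RF_fpf m z"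
proof -
  obtain u v r where ws: "ws = u # v # r" using RF_ConsE[OF assms(1,2)] .
  with assms show ?thesis
    using that f_odd_op_iff[of u v r ws'] RF_ConsD[of u v r m z] odd_step_RF[of u v _ _ r m z] by blast
qed

lemma e_odd_op_step:
  assumes "ws' \<in> RF_fpf m z" "2 \<le> m" "e_odd_op ws' = Some ws"
  obtains u v u' v' r where "ws = u # v # r" "ws' = u' # v' # r" "odd_step u v u' v'" "ws \<in> RF_fpf m z"
proof -
  obtain u' v' r where ws: "ws' = u' # v' # r" using RF_ConsE[OF assms(1,2)] .
  with assms show ?thesis
    using that e_odd_op_sound[of u' v' r m z ws] by blast
qed

lemma odd_step_ops:
  assumes "odd_step u v u' v'" "u # v # r \<in> RF_fpf m z"
  shows "f_odd_op (u # v # r) = Some (u' # v' # r)" "e_odd_op (u' # v' # r) = Some (u # v # r)"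
proof -
  note uv = RF_ConsD[OF assms(2)]
  have "u \<noteq> []" using assms(1) by (auto elim: odd_step.cases)
  then have "0 < hd u" using uv(4) by (cases u) auto
  then show "f_odd_op (u # v # r) = Some (u' # v' # r)" "e_odd_op (u' # v' # r) = Some (u # v # r)"
    using assms(1) uv f_odd_op_iff e_odd_op_complete by auto
qed

section \<open>The q(m)-crystal axioms\<close>

theorem theorem5p8:
  fixes z :: "nat \<Rightarrow> nat" and m :: nat
  assumes "z \<in> F_inf" and "m \<ge> 2"
  shows "q_crystal m (RF_fpf m z) rf_wt e_even f_even e_odd_op f_odd_op"
proof -
  interpret gl_crystal m "RF_fpf m z" rf_wt e_even f_even by (rule gl_crystal_RF)
  show ?thesis
  proof
    fix ws ws' assume ws: "ws \<in> RF_fpf m z"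
    show "0 \<le> Poly_Mapping.lookup (rf_wt ws) i" for i by (simp add: lookup_rf_wt)
    {
      assume e: "e_odd_op ws = Some ws'"
      obtain u v u' v' r where step: "ws' = u # v # r" "ws = u' # v' # r" "odd_step u v u' v'" "ws' \<in> RF_fpf m z"
        using e_odd_op_step[OF ws assms(2) e] .
      show "ws' \<in> RF_fpf m z" by (fact step(4))
      show "rf_wt ws' = rf_wt ws + simple_root 1"
        using rf_wt_odd_step[OF step(3), of r] by (simp add: step(1,2))
      fix i :: nat assume i: "3 \<le> i" "i < m"
      \<comment> \<open>The blocks \<open>i\<close> and \<open>i + 1\<close> lie in
        \<open>r\<close>, which the odd step leaves alone, so the counts of unpaired letters
        agree.\<close>
      then have "i = Suc (Suc (Suc (i - 3)))" by simp
      then obtain k where "i = Suc (Suc (Suc k))" ..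
      then have "phi i ws' = phi i ws" "eps i ws' = eps i ws"
        by (simp_all add: phi_def eps_def step(1,2))
      then show "string_length (RF_fpf m z) (e_even i) ws' = string_length (RF_fpf m z) (e_even i) ws"
        "string_length (RF_fpf m z) (f_even i) ws' = string_length (RF_fpf m z) (f_even i) ws"
        using i ws step(4) by (simp_all add: string_length_def string_set_f_even string_set_e_even)
    next
      assume f: "f_odd_op ws = Some ws'"
      obtain u v u' v' r where step: "ws = u # v # r" "ws' = u' # v' # r" "odd_step u v u' v'" "ws' \<in> RF_fpf m z"
        using f_odd_op_step[OF ws assms(2) f] .
      show "ws' \<in> RF_fpf m z" by (fact step(4))
      show "rf_wt ws' = rf_wt ws - simple_root 1"
        using rf_wt_odd_step[OF step(3), of r] by (simp add: step(1,2))
    next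
      assume ws': "ws' \<in> RF_fpf m z"
      show "f_odd_op ws = Some ws' \<longleftrightarrow> e_odd_op ws' = Some ws"
      proof
        assume f: "f_odd_op ws = Some ws'"
        obtain u v u' v' r where step: "ws = u # v # r" "ws' = u' # v' # r" "odd_step u v u' v'" "ws' \<in> RF_fpf m z"
          using f_odd_op_step[OF ws assms(2) f] .
        show "e_odd_op ws' = Some ws" using odd_step_ops(2)[OF step(3)] ws by (simp add: step(1,2))
      next
        assume e: "e_odd_op ws' = Some ws"
        obtain u v u' v' r where step: "ws = u # v # r" "ws' = u' # v' # r" "odd_step u v u' v'" "ws \<in> RF_fpf m z"
          using e_odd_op_step[OF ws' assms(2) e] .
        show "f_odd_op ws = Some ws'" using odd_step_ops(1)[OF step(3)] ws by (simp add: step(1,2))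
      qed
    next
      fix i :: nat assume i: "3 \<le> i" "i < m"
      obtain u v r where uvr: "ws = u # v # r" using RF_ConsE[OF ws assms(2)] .
      show "Option.bind (e_even i ws) e_odd_op = Option.bind (e_odd_op ws) (e_even i)"
        "Option.bind (f_even i ws) e_odd_op = Option.bind (e_odd_op ws) (f_even i)"
        "Option.bind (e_even i ws) f_odd_op = Option.bind (f_odd_op ws) (e_even i)"
        "Option.bind (f_even i ws) f_odd_op = Option.bind (f_odd_op ws) (f_even i)"
        unfolding uvr
        by (rule local_ops_commute[OF odd_op_local(2) even_op_local(2)[OF i(1)]]
            local_ops_commute[OF odd_op_local(2) even_op_local(1)[OF i(1)]]
            local_ops_commute[OF odd_op_local(1) even_op_local(2)[OF i(1)]]
            local_ops_commute[OF odd_op_local(1) even_op_local(1)[OF i(1)]])+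
    }
  qed
qed
end
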